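(* Let $\sigma:\mathbb{T}\times\mathbb{Z}\to\mathbb{C}$ be a measurable function such that $\sigma(\cdot,k)\in L^2(\mathbb{T})$ for each $k\in\mathbb{Z}$, and let $T_\sigma$ be its associated pseudo-differential operator. Then $T_\sigma$ defines a bounded operator on $L^2(\mathbb{T})$ if and only if the rows of the associated matrix $M_\sigma$ are in $L^2(\mathbb{Z})$ and $$\sup_{n\in\mathbb{N}}\|M_{\sigma,n}\|_{\mathcal{L}(\ell^2(\mathbb{C}^{2n+1}))}<\infty,$$ where $M_{\sigma,n}$ is the $(2n+1)\times(2n+1)$ matrix with entries $$(M_{\sigma,n})_{jk}:=\overline{\langle\sigma(x,j)e^{ixj}\,|\,\sigma(x,k)e^{ixk}\rangle}_{L^2(\mathbb{T})},\qquad |j|,|k|\le n.$$ When this happens, $$\sup_{n\in\mathbb{N}}\|M_{\sigma,n}\|_{\mathcal{L}(\ell^2(\mathbb{C}^{2n+1}))}=\|T_\sigma\|^2_{\mathcal{L}(L^2(\mathbb{T}))}.$$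
   Context: $\mathbb{T}=\mathbb{R}/2\pi\mathbb{Z}$ with normalized Haar measure $dx$; $\widehat f(k)=\int_{\mathbb{T}}f(x)e^{-ixk}\,dx$; $L^2(\mathbb{Z})$ is $\ell^2(\mathbb{Z})$. The inner product is $\langle f|g\rangle_{L^2(\mathbb{T})}=\int_{\mathbb{T}}f\overline g\,dx$, and $\ell^2(\mathbb{C}^{2n+1})$ is $\mathbb{C}^{2n+1}$ with the Euclidean norm. For $\sigma$ with $\sigma(\cdot,k)\in L^2(\mathbb{T})$ for each $k$, the associated pseudo-differential operator is defined on trigonometric polynomials by $(T_\sigma f)(x)=\sum_{k\in\mathbb{Z}}\sigma(x,k)\widehat f(k)e^{ixk}$; "defines a bounded operator on $L^2(\mathbb{T})$" means that it extends to an element of $\mathcal{L}(L^2(\mathbb{T}))$. The associated matrix of $T_\sigma$ is the infinite matrix with entries $(M_\sigma)_{jk}=\widehat\sigma(j-k,k)=\int_{\mathbb{T}}\sigma(x,k)e^{-ix(j-k)}dx$, $j,k\in\mathbb{Z}$. *)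

theory Defs
  imports "HOL-Analysis.Analysis"
begin

text \<open>
  The torus R/2\<pi>Z is represented by its fundamental domain [0, 2\<pi>) with normalized Lebesgue
  measure, and functions on the torus by functions on the reals of which only the values on that
  domain matter; no periodicity is imposed outside it.
\<close>

definition torus :: "real measure" where
  "torus = density (lebesgue_on {0..<2 * pi}) (\<lambda>_. ennreal (1 / (2 * pi)))"

lemma space_torus: "space torus = {0..<2 * pi}"
  by (simp add: torus_def)

lemma emeasure_torus: "emeasure torus (space torus) = 1"
proof -
  have "emeasure lebesgue {0..<2 * pi} = ennreal (2 * pi)"
    by simp
  then have "emeasure (lebesgue_on {0..<2 * pi}) {0..<2 * pi} = ennreal (2 * pi)"
    by (simp add: emeasure_restrict_space)
  then have "emeasure torus {0..<2 * pi} = ennreal (1 / (2 * pi)) * ennreal (2 * pi)"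
    unfolding torus_def by (subst emeasure_density_const) (auto simp: sets_restrict_space_iff)
  also have "\<dots> = 1"
    by (subst ennreal_mult'[symmetric]) auto
  finally show ?thesis
    by (simp add: space_torus)
qed

definition chr :: "int \<Rightarrow> real \<Rightarrow> complex" where
  "chr k x = exp (\<i> * complex_of_real x * of_int k)"

definition fourier :: "(real \<Rightarrow> complex) \<Rightarrow> int \<Rightarrow> complex" where
  "fourier f k = (LINT x|torus. f x * exp (- \<i> * complex_of_real x * of_int k))"


subsection \<open>The space of square-integrable functions and its bounded operators\<close>

definition L2_torus :: "(real \<Rightarrow> complex) set" where
  "L2_torus = {f \<in> borel_measurable torus. integrable torus (\<lambda>x. (cmod (f x))\<^sup>2)}"

definition inner_torus :: "(real \<Rightarrow> complex) \<Rightarrow> (real \<Rightarrow> complex) \<Rightarrow> complex" where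
  "inner_torus f g = (LINT x|torus. f x * cnj (g x))"

definition norm_torus :: "(real \<Rightarrow> complex) \<Rightarrow> real" where
  "norm_torus f = sqrt (LINT x|torus. (cmod (f x))\<^sup>2)"

text \<open>
  Elements of the Lebesgue space are classes of functions modulo equality almost everywhere; an
  operator is given here by its action on representatives. Linearity holds almost everywhere,
  and together with the norm bound it makes the operator respect almost everywhere equality
  (lemma bounded_operator_cong_AE), so it acts on classes. Conversely, every bounded operator
  on classes arises in this way, by choosing representatives of its values.
\<close>

definition bounded_operator :: "((real \<Rightarrow> complex) \<Rightarrow> real \<Rightarrow> complex) \<Rightarrow> bool" where
  "bounded_operator A \<longleftrightarrow>
     (\<forall>f\<in>L2_torus. A f \<in> L2_torus) \<and>
     (\<forall>f\<in>L2_torus. \<forall>g\<in>L2_torus. AE x in torus. A (\<lambda>y. f y + g y) x = A f x + A g x) \<and>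
     (\<forall>c. \<forall>f\<in>L2_torus. AE x in torus. A (\<lambda>y. c * f y) x = c * A f x) \<and>
     (\<exists>C. \<forall>f\<in>L2_torus. norm_torus (A f) \<le> C * norm_torus f)"

definition operator_norm :: "((real \<Rightarrow> complex) \<Rightarrow> real \<Rightarrow> complex) \<Rightarrow> real" where
  "operator_norm A = Sup {norm_torus (A f) | f. f \<in> L2_torus \<and> norm_torus f \<le> 1}"

lemma bounded_operator_cong_AE:
  assumes A: "bounded_operator A" and f: "f \<in> L2_torus" and g: "g \<in> L2_torus"
    and eq: "AE x in torus. f x = g x"
  shows "AE x in torus. A f x = A g x"
proof -
  define h where "h x = f x + (- 1) * g x" for x
  have m: "(\<lambda>x. - 1 * g x) \<in> L2_torus"
    using g by (auto simp: L2_torus_def)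
  have h0: "AE x in torus. h x = 0"
    using eq by (auto simp: h_def)
  have hm: "h \<in> borel_measurable torus"
    using f g unfolding h_def L2_torus_def by auto
  have int0: "integrable torus (\<lambda>x. (cmod (h x))\<^sup>2)"
    using h0 hm by (subst integrable_cong_AE[where g = "\<lambda>_. 0"]) auto
  have "(LINT x|torus. (cmod (h x))\<^sup>2) = (LINT x|torus. 0)"
    using h0 hm by (intro integral_cong_AE) auto
  then have n0: "norm_torus h = 0"
    by (simp add: norm_torus_def)
  have h: "h \<in> L2_torus"
    using hm int0 by (simp add: L2_torus_def)
  obtain C where "\<forall>f\<in>L2_torus. norm_torus (A f) \<le> C * norm_torus f"
    using A by (auto simp: bounded_operator_def)
  with h n0 have le0: "norm_torus (A h) \<le> 0"
    by force
  have Ah: "A h \<in> L2_torus"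
    using A h by (auto simp: bounded_operator_def)
  have "0 \<le> (LINT x|torus. (cmod (A h x))\<^sup>2)"
    by (rule Bochner_Integration.integral_nonneg) auto
  with le0 have "(LINT x|torus. (cmod (A h x))\<^sup>2) = 0"
    by (simp add: norm_torus_def)
  then have z: "AE x in torus. A h x = 0"
    using Ah by (subst (asm) integral_nonneg_eq_0_iff_AE) (auto simp: L2_torus_def)
  have "AE x in torus. A (\<lambda>y. f y + (- 1 * g y)) x = A f x + A (\<lambda>y. - 1 * g y) x"
  proof -
    have "\<forall>f\<in>L2_torus. \<forall>g\<in>L2_torus. AE x in torus. A (\<lambda>y. f y + g y) x = A f x + A g x"
      using A by (simp add: bounded_operator_def)
    from bspec[OF bspec[OF this f] m] show ?thesis .
  qed
  moreover have "AE x in torus. A (\<lambda>y. - 1 * g y) x = - 1 * A g x"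
  proof -
    have "\<forall>c. \<forall>f\<in>L2_torus. AE x in torus. A (\<lambda>y. c * f y) x = c * A f x"
      using A by (simp add: bounded_operator_def)
    from bspec[OF spec[OF this] g] show ?thesis .
  qed
  ultimately show ?thesis
    using z by eventually_elim (simp add: h_def[abs_def])
qed


subsection \<open>Pseudo-differential operators\<close>

definition trig_polynomials :: "(real \<Rightarrow> complex) set" where
  "trig_polynomials = {f. \<exists>K c. finite K \<and> f = (\<lambda>x. \<Sum>k\<in>K. c k * chr k x)}"

text \<open>Only applied to trigonometric polynomials, for which the sum has finite support.\<close>

definition pdo :: "(real \<Rightarrow> int \<Rightarrow> complex) \<Rightarrow> (real \<Rightarrow> complex) \<Rightarrow> real \<Rightarrow> complex" where
  "pdo \<sigma> f x = (\<Sum>\<^sub>\<infinity>k\<in>UNIV. \<sigma> x k * fourier f k * chr k x)"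

definition bounded_extension_pdo ::
    "(real \<Rightarrow> int \<Rightarrow> complex) \<Rightarrow> ((real \<Rightarrow> complex) \<Rightarrow> real \<Rightarrow> complex) \<Rightarrow> bool" where
  "bounded_extension_pdo \<sigma> A \<longleftrightarrow>
     bounded_operator A \<and> (\<forall>f\<in>trig_polynomials. AE x in torus. A f x = pdo \<sigma> f x)"

definition assoc_matrix :: "(real \<Rightarrow> int \<Rightarrow> complex) \<Rightarrow> int \<Rightarrow> int \<Rightarrow> complex" where
  "assoc_matrix \<sigma> j k = fourier (\<lambda>x. \<sigma> x k) (j - k)"

definition gram_matrix :: "(real \<Rightarrow> int \<Rightarrow> complex) \<Rightarrow> int \<Rightarrow> int \<Rightarrow> complex" where
  "gram_matrix \<sigma> j k = cnj (inner_torus (\<lambda>x. \<sigma> x j * chr j x) (\<lambda>x. \<sigma> x k * chr k x))"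

text \<open>
  Norm, as an operator on the Euclidean space of dimension 2n+1, of the section of M with both
  indices in {-n..n}. Vectors are functions of which only the values on {-n..n} matter.
\<close>

definition section_norm :: "nat \<Rightarrow> (int \<Rightarrow> int \<Rightarrow> complex) \<Rightarrow> real" where
  "section_norm n M =
     Sup {L2_set (\<lambda>j. cmod (\<Sum>k\<in>{- int n..int n}. M j k * v k)) {- int n..int n} | v.
          L2_set (\<lambda>k. cmod (v k)) {- int n..int n} \<le> 1}"

end

theory Submission
  imports Defs
begin

text \<open>
  Put \<open>u\<^sub>k(x) = \<sigma>(x,k) e\<^sup>i\<^sup>k\<^sup>x\<close>, the image of the character of frequency \<open>k\<close>. On trigonometric
  polynomials the operator sends \<open>\<Sum> v\<^sub>k e\<^sup>i\<^sup>k\<^sup>x\<close> to \<open>\<Sum> v\<^sub>k u\<^sub>k\<close>, and since the characters are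
  orthonormal the argument has the Euclidean norm of \<open>v\<close>. So everything is a statement about the
  synthesis map \<open>U v = \<Sum> v\<^sub>k u\<^sub>k\<close> on finitely supported vectors. The matrix in the theorem is the
  Gram matrix of the \<open>u\<^sub>k\<close>, that is \<open>U\<^sup>* U\<close>, and the identity \<open>\<parallel>U\<^sup>* U\<parallel> = \<parallel>U\<parallel>\<^sup>2\<close> on each finite section
  (\<open>section_norm_gram_le\<close> and \<open>norm_synthesis_le_section\<close>) shows that the supremum of the section
  norms is the square of the best constant in \<open>\<parallel>U v\<parallel> \<le> C \<parallel>v\<parallel>\<close>.

  If an extension \<open>A\<close> exists, its norm is such a constant. The rows of the associated matrix are
  \<open>k \<mapsto> \<langle>u\<^sub>k | e\<^sup>i\<^sup>j\<^sup>x\<rangle>\<close>, the conjugate of \<open>U\<^sup>*\<close> applied to a character, hence square summable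
  (\<open>row_summable\<close>). Conversely, given a finite constant \<open>C\<close>, Bessel's inequality makes the sums
  \<open>\<Sum>\<^bsub>\<bar>k\<bar>\<le>N\<^esub> f\<^sub>k u\<^sub>k\<close> over the Fourier coefficients \<open>f\<^sub>k\<close> of \<open>f\<close> Cauchy in the mean, and
  their limit, provided by the Riesz-Fischer theorem (\<open>L2_torus_complete\<close>), defines the extension
  (\<open>bounded_operator_synthesis\<close>).

  The norm of an arbitrary extension is at most the best constant \<open>C\<close> because trigonometric
  polynomials are dense (\<open>trig_polynomials_dense\<close>, by Stone-Weierstrass on the circle) and the bound
  on them passes to limits (\<open>operator_norm_le_of_dense\<close>).
\<close>

section \<open>The Hilbert space geometry of square-integrable functions\<close>

lemma finite_measure_torus: "finite_measure torus"
  by (rule finite_measureI) (simp add: emeasure_torus)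

interpretation torus: finite_measure torus
  by (rule finite_measure_torus)

lemma measure_torus: "measure torus (space torus) = 1"
  by (simp add: measure_def emeasure_torus)

lemma borel_measurable_cnj [measurable]: "cnj \<in> borel_measurable borel"
  by (rule borel_measurable_continuous_onI) (intro continuous_intros)

lemma L2_integrable_mult:
  assumes "f \<in> L2_torus" "g \<in> L2_torus"
  shows "integrable torus (\<lambda>x. f x * cnj (g x))"
proof (rule Bochner_Integration.integrable_bound)
  show "integrable torus (\<lambda>x. (cmod (f x))\<^sup>2 + (cmod (g x))\<^sup>2)"
    using assms by (auto simp: L2_torus_def)
  have m: "f \<in> borel_measurable torus" "g \<in> borel_measurable torus"
    using assms by (auto simp: L2_torus_def)
  show "(\<lambda>x. f x * cnj (g x)) \<in> borel_measurable torus"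
    using m by measurable
  have "norm (f x * cnj (g x)) \<le> norm ((cmod (f x))\<^sup>2 + (cmod (g x))\<^sup>2)" for x
    using sum_squares_bound[of "cmod (f x)" "cmod (g x)"]
      mult_nonneg_nonneg[of "cmod (f x)" "cmod (g x)"]
    by (simp add: norm_mult del: mult_nonneg_nonneg zero_le_mult_iff)
  then show "AE x in torus. norm (f x * cnj (g x)) \<le> norm ((cmod (f x))\<^sup>2 + (cmod (g x))\<^sup>2)"
    by simp
qed

lemma L2_add [intro]:
  assumes "f \<in> L2_torus" "g \<in> L2_torus"
  shows "(\<lambda>x. f x + g x) \<in> L2_torus"
proof -
  have m: "f \<in> borel_measurable torus" "g \<in> borel_measurable torus"
    using assms by (auto simp: L2_torus_def)
  have "integrable torus (\<lambda>x. (cmod (f x + g x))\<^sup>2)"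
  proof (rule Bochner_Integration.integrable_bound)
    show "integrable torus (\<lambda>x. 2 * (cmod (f x))\<^sup>2 + 2 * (cmod (g x))\<^sup>2)"
      using assms by (auto simp: L2_torus_def)
    show "(\<lambda>x. (cmod (f x + g x))\<^sup>2) \<in> borel_measurable torus"
      using m by measurable
    have "(cmod (f x + g x))\<^sup>2 \<le> 2 * (cmod (f x))\<^sup>2 + 2 * (cmod (g x))\<^sup>2" for x
    proof -
      have "(cmod (f x + g x))\<^sup>2 \<le> (cmod (f x) + cmod (g x))\<^sup>2"
        by (simp add: norm_triangle_ineq power_mono)
      also have "\<dots> \<le> 2 * (cmod (f x))\<^sup>2 + 2 * (cmod (g x))\<^sup>2"
        using sum_squares_bound[of "cmod (f x)" "cmod (g x)"]
        by (simp add: power2_sum)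
      finally show ?thesis .
    qed
    then show "AE x in torus. norm ((cmod (f x + g x))\<^sup>2) \<le> norm (2 * (cmod (f x))\<^sup>2 + 2 * (cmod (g x))\<^sup>2)"
      by (simp add: abs_of_nonneg)
  qed
  with m show ?thesis
    by (simp add: L2_torus_def)
qed

lemma L2_scale [intro]: "f \<in> L2_torus \<Longrightarrow> (\<lambda>x. c * f x) \<in> L2_torus"
  by (auto simp: L2_torus_def norm_mult power_mult_distrib)

lemma L2_diff [intro]: "f \<in> L2_torus \<Longrightarrow> g \<in> L2_torus \<Longrightarrow> (\<lambda>x. f x - g x) \<in> L2_torus"
  using L2_add[OF _ L2_scale, of f g "-1"] by simp

lemma L2_zero [intro, simp]: "(\<lambda>x. 0) \<in> L2_torus"
  by (simp add: L2_torus_def)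

lemma L2_sum [intro]:
  "(\<And>i. i \<in> I \<Longrightarrow> F i \<in> L2_torus) \<Longrightarrow> (\<lambda>x. \<Sum>i\<in>I. F i x) \<in> L2_torus"
  by (induction I rule: infinite_finite_induct) auto

lemma L2_bounded:
  assumes "f \<in> borel_measurable torus" "\<And>x. cmod (f x) \<le> B"
  shows "f \<in> L2_torus"
proof -
  have "integrable torus (\<lambda>x. (cmod (f x))\<^sup>2)"
  proof (rule torus.integrable_const_bound[where B = "B\<^sup>2"])
    show "AE x in torus. norm ((cmod (f x))\<^sup>2) \<le> B\<^sup>2"
      using assms(2) by (auto intro!: AE_I2 power_mono simp: abs_of_nonneg)
  qed (use assms in measurable)
  with assms show ?thesis by (simp add: L2_torus_def)
qed

lemma inner_add_left:
  assumes "f \<in> L2_torus" "g \<in> L2_torus" "h \<in> L2_torus"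
  shows "inner_torus (\<lambda>x. f x + g x) h = inner_torus f h + inner_torus g h"
  unfolding inner_torus_def distrib_right
  by (rule Bochner_Integration.integral_add) (use assms L2_integrable_mult in auto)

lemma inner_scale_left: "inner_torus (\<lambda>x. c * f x) h = c * inner_torus f h"
  unfolding inner_torus_def mult.assoc by simp

lemma inner_commute_cnj: "inner_torus f g = cnj (inner_torus g f)"
  using Bochner_Integration.integral_cnj[of torus "\<lambda>x. g x * cnj (f x)"] by (simp add: inner_torus_def mult.commute)

lemma inner_sum_left:
  assumes "\<And>i. i \<in> I \<Longrightarrow> F i \<in> L2_torus" "h \<in> L2_torus"
  shows "inner_torus (\<lambda>x. \<Sum>i\<in>I. c i * F i x) h = (\<Sum>i\<in>I. c i * inner_torus (F i) h)"
proof -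
  have "inner_torus (\<lambda>x. \<Sum>i\<in>I. c i * F i x) h
      = (LINT x|torus. (\<Sum>i\<in>I. c i * (F i x * cnj (h x))))"
    by (simp add: inner_torus_def sum_distrib_right mult.assoc)
  also have "\<dots> = (\<Sum>i\<in>I. LINT x|torus. c i * (F i x * cnj (h x)))"
    by (rule Bochner_Integration.integral_sum) (use assms L2_integrable_mult in auto)
  finally show ?thesis by (simp add: inner_torus_def)
qed

lemma inner_sum_right:
  assumes "\<And>i. i \<in> I \<Longrightarrow> F i \<in> L2_torus" "h \<in> L2_torus"
  shows "inner_torus h (\<lambda>x. \<Sum>i\<in>I. c i * F i x) = (\<Sum>i\<in>I. cnj (c i) * inner_torus h (F i))"
  by (subst inner_commute_cnj, subst inner_sum_left)
     (use assms in \<open>auto simp: inner_commute_cnj[of h]\<close>)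

lemma norm_torus_nonneg [simp]: "0 \<le> norm_torus f"
  by (simp add: norm_torus_def)

lemma norm_torus_square: "(norm_torus f)\<^sup>2 = (LINT x|torus. (cmod (f x))\<^sup>2)"
  by (simp add: norm_torus_def)

lemma inner_self: "inner_torus f f = of_real ((norm_torus f)\<^sup>2)"
  unfolding inner_torus_def norm_torus_square complex_norm_square[symmetric] integral_complex_of_real ..

lemma norm_torus_scale: "norm_torus (\<lambda>x. c * f x) = cmod c * norm_torus f"
  by (simp add: norm_torus_def norm_mult power_mult_distrib real_sqrt_mult)

lemma norm_torus_minus_commute: "norm_torus (\<lambda>x. f x - g x) = norm_torus (\<lambda>x. g x - f x)"
  by (simp add: norm_torus_def norm_minus_commute)

lemma norm_torus_cong_AE:
  assumes "f \<in> L2_torus" "g \<in> L2_torus" "AE x in torus. f x = g x"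
  shows "norm_torus f = norm_torus g"
proof -
  have "(LINT x|torus. (cmod (f x))\<^sup>2) = (LINT x|torus. (cmod (g x))\<^sup>2)"
    using assms by (intro integral_cong_AE) (auto simp: L2_torus_def)
  then show ?thesis by (simp add: norm_torus_def)
qed

lemma norm_torus_eq_0_imp_AE:
  assumes "f \<in> L2_torus" "norm_torus f = 0"
  shows "AE x in torus. f x = 0"
proof -
  have "(LINT x|torus. (cmod (f x))\<^sup>2) = 0"
    using assms(2) norm_torus_square[of f] by simp
  then show ?thesis
    using assms(1) by (subst (asm) integral_nonneg_eq_0_iff_AE) (auto simp: L2_torus_def)
qed

lemma norm_torus_add_square:
  assumes "f \<in> L2_torus" "g \<in> L2_torus"
  shows "(norm_torus (\<lambda>x. f x + g x))\<^sup>2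
       = (norm_torus f)\<^sup>2 + 2 * Re (inner_torus f g) + (norm_torus g)\<^sup>2"
proof -
  let ?s = "\<lambda>x. f x + g x"
  have s: "?s \<in> L2_torus" using assms by auto
  have "inner_torus ?s ?s = inner_torus f ?s + inner_torus g ?s"
    using assms s by (intro inner_add_left)
  also have "inner_torus f ?s = cnj (inner_torus f f + inner_torus g f)"
    using assms s by (subst inner_commute_cnj) (subst inner_add_left, auto)
  also have "inner_torus g ?s = cnj (inner_torus f g + inner_torus g g)"
    using assms s by (subst inner_commute_cnj) (subst inner_add_left, auto)
  finally have "Re (inner_torus ?s ?s) = Re (cnj (inner_torus f f + inner_torus g f)
      + cnj (inner_torus f g + inner_torus g g))" by simp
  moreover have "Re (inner_torus g f) = Re (inner_torus f g)"
    by (subst inner_commute_cnj) simp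
  ultimately show ?thesis
    by (simp add: inner_self)
qed

text \<open>
  The nonnegative quantity \<open>\<parallel>f - t z g\<parallel>\<^sup>2\<close> with \<open>z = \<langle>f|g\<rangle>\<close> is a real quadratic polynomial in the real
  number \<open>t\<close>; the bound comes from its minimum at \<open>t = 1 / \<parallel>g\<parallel>\<^sup>2\<close>. As the norm is only a seminorm
  on functions, \<open>\<parallel>g\<parallel> = 0\<close> is a separate case: there the polynomial is affine in \<open>t\<close>, so its slope
  has to vanish.
\<close>

lemma Cauchy_Schwarz_torus:
  assumes "f \<in> L2_torus" "g \<in> L2_torus"
  shows "cmod (inner_torus f g) \<le> norm_torus f * norm_torus g"
proof -
  define z where "z = inner_torus f g"
  define a where "a = norm_torus f"
  define b where "b = norm_torus g"
  have main: "0 \<le> a\<^sup>2 - 2 * t * (cmod z)\<^sup>2 + t\<^sup>2 * (cmod z)\<^sup>2 * b\<^sup>2" for t :: real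
  proof -
    define c where "c = - of_real t * z"
    define h where "h x = c * g x" for x
    have h: "h \<in> L2_torus"
      unfolding h_def[abs_def] by (rule L2_scale[OF assms(2)])
    have "inner_torus h f = c * inner_torus g f"
      unfolding h_def[abs_def] by (rule inner_scale_left)
    then have "inner_torus f h = cnj c * z"
      unfolding inner_commute_cnj[of f h] inner_commute_cnj[of g f] z_def by simp
    also have "\<dots> = - of_real t * (z * cnj z)"
      by (simp add: c_def)
    also have "\<dots> = of_real (- t * (cmod z)\<^sup>2)"
      by (simp only: complex_norm_square[symmetric] of_real_mult of_real_minus)
    finally have e: "Re (inner_torus f h) = - t * (cmod z)\<^sup>2"
      by (simp only: Re_complex_of_real)
    have "norm_torus h = \<bar>t\<bar> * cmod z * b"
      unfolding h_def[abs_def] norm_torus_scale by (simp add: c_def b_def norm_mult)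
    then have "(norm_torus h)\<^sup>2 = t\<^sup>2 * (cmod z)\<^sup>2 * b\<^sup>2"
      by (simp add: power_mult_distrib)
    then have "(norm_torus (\<lambda>x. f x + h x))\<^sup>2 = a\<^sup>2 - 2 * t * (cmod z)\<^sup>2 + t\<^sup>2 * (cmod z)\<^sup>2 * b\<^sup>2"
      unfolding norm_torus_add_square[OF assms(1) h] e by (simp add: a_def)
    with zero_le_power2[of "norm_torus (\<lambda>x. f x + h x)"] show ?thesis by simp
  qed
  have ab: "0 \<le> a" "0 \<le> b" by (simp_all add: a_def b_def)
  define w where "w = (cmod z)\<^sup>2"
  have main': "0 \<le> a\<^sup>2 - 2 * t * w + t\<^sup>2 * w * b\<^sup>2" for t :: real
    using main[of t] by (simp only: w_def)
  have "w \<le> (a * b)\<^sup>2"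
  proof (cases "b = 0")
    case True
    have "w = 0"
    proof (rule ccontr)
      assume w: "w \<noteq> 0"
      \<comment> \<open>a value of the parameter at which the affine function equals \<open>-1\<close>\<close>
      define s where "s = (a\<^sup>2 + 1) / (2 * w)"
      have "2 * s * w = a\<^sup>2 + 1"
        unfolding s_def using w by simp
      moreover have "s\<^sup>2 * w * b\<^sup>2 = 0"
        using True by simp
      ultimately show False
        using main'[of s] by linarith
    qed
    then show ?thesis using True by simp
  next
    case False
    then have "(1 / b\<^sup>2)\<^sup>2 * w * b\<^sup>2 = w / b\<^sup>2"
      by (simp add: power2_eq_square)
    moreover have "2 * (1 / b\<^sup>2) * w = 2 * (w / b\<^sup>2)"
      by simp
    ultimately have "w / b\<^sup>2 \<le> a\<^sup>2"
      using main'[of "1 / b\<^sup>2"] by linarith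
    moreover have "0 < b\<^sup>2" using False by simp
    ultimately have "w \<le> a\<^sup>2 * b\<^sup>2"
      by (simp only: pos_divide_le_eq)
    then show ?thesis
      by (simp only: power_mult_distrib)
  qed
  then have "(cmod z)\<^sup>2 \<le> (a * b)\<^sup>2"
    by (simp only: w_def)
  then have "cmod z \<le> a * b"
    by (rule power2_le_imp_le) (simp add: ab)
  then show ?thesis by (simp add: z_def a_def b_def)
qed

lemma norm_torus_triangle:
  assumes "f \<in> L2_torus" "g \<in> L2_torus"
  shows "norm_torus (\<lambda>x. f x + g x) \<le> norm_torus f + norm_torus g"
proof (rule power2_le_imp_le)
  have "Re (inner_torus f g) \<le> norm_torus f * norm_torus g"
    using Cauchy_Schwarz_torus[OF assms] complex_Re_le_cmod order_trans by blast
  then show "(norm_torus (\<lambda>x. f x + g x))\<^sup>2 \<le> (norm_torus f + norm_torus g)\<^sup>2"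
    by (simp add: norm_torus_add_square[OF assms] power2_sum)
qed simp

lemma norm_torus_triangle_diff:
  assumes "f \<in> L2_torus" "g \<in> L2_torus" "h \<in> L2_torus"
  shows "norm_torus (\<lambda>x. f x - h x) \<le> norm_torus (\<lambda>x. f x - g x) + norm_torus (\<lambda>x. g x - h x)"
  using norm_torus_triangle[OF L2_diff[OF assms(1,2)] L2_diff[OF assms(2,3)]] by simp

lemma norm_torus_le_add_diff:
  assumes "f \<in> L2_torus" "g \<in> L2_torus"
  shows "norm_torus f \<le> norm_torus g + norm_torus (\<lambda>x. f x - g x)"
  using norm_torus_triangle[OF assms(2) L2_diff[OF assms(1,2)]] by simp

text \<open>
  The torus has total mass one, so the inequality is Cauchy-Schwarz against the constant one.
\<close>

lemma integral_norm_le_norm_torus: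
  assumes "f \<in> L2_torus"
  shows "integrable torus f" "(LINT x|torus. cmod (f x)) \<le> norm_torus f"
proof -
  have one: "(\<lambda>x. 1) \<in> L2_torus" by (rule L2_bounded[where B = 1]) auto
  show "integrable torus f"
    using L2_integrable_mult[OF assms one] by simp
  let ?g = "\<lambda>x. of_real (cmod (f x)) :: complex"
  have g: "?g \<in> L2_torus" using assms by (auto simp: L2_torus_def)
  have "cmod (inner_torus ?g (\<lambda>x. 1)) \<le> norm_torus ?g * norm_torus (\<lambda>x. 1)"
    by (rule Cauchy_Schwarz_torus[OF g one])
  moreover have "norm_torus ?g = norm_torus f" "norm_torus (\<lambda>x. 1) = 1"
    by (simp_all add: norm_torus_def measure_torus)
  moreover have "inner_torus ?g (\<lambda>x. 1) = of_real (LINT x|torus. cmod (f x))"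
    by (simp add: inner_torus_def)
  ultimately show "(LINT x|torus. cmod (f x)) \<le> norm_torus f"
    by simp
qed

lemma nn_integral_square_eq_norm_torus:
  assumes "f \<in> L2_torus"
  shows "(\<integral>\<^sup>+x. ennreal ((cmod (f x))\<^sup>2) \<partial>torus) = ennreal ((norm_torus f)\<^sup>2)"
  unfolding norm_torus_square
  by (rule nn_integral_eq_integral) (use assms in \<open>auto simp: L2_torus_def\<close>)

text \<open>
  Fatou's lemma bounds nonnegative integrals of limits that are not yet known to be
  square-integrable; this turns such a bound into membership together with a norm estimate.
\<close>

lemma L2_and_norm_le_of_nn_integral:
  assumes "f \<in> borel_measurable torus" "0 \<le> e"
    and "(\<integral>\<^sup>+x. ennreal ((cmod (f x))\<^sup>2) \<partial>torus) \<le> ennreal (e\<^sup>2)"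
  shows "f \<in> L2_torus" "norm_torus f \<le> e"
proof -
  show f: "f \<in> L2_torus"
    unfolding L2_torus_def
  proof (intro CollectI conjI integrableI_bounded)
    have "(\<integral>\<^sup>+x. ennreal ((cmod (f x))\<^sup>2) \<partial>torus) < \<infinity>"
      using assms(3) by (rule le_less_trans) simp
    then show "(\<integral>\<^sup>+x. ennreal (norm ((cmod (f x))\<^sup>2)) \<partial>torus) < \<infinity>" by simp
  qed (use assms in measurable)
  have "(norm_torus f)\<^sup>2 \<le> e\<^sup>2"
    using assms(3) by (simp add: nn_integral_square_eq_norm_torus[OF f])
  then show "norm_torus f \<le> e"
    using assms(2) by (rule power2_le_imp_le)
qed

text \<open>
  Riesz-Fischer. Along a subsequence with consecutive distances below \<open>2\<^sup>-\<^sup>k\<close> the increments are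
  absolutely summable almost everywhere, because their \<open>L\<^sup>1\<close> norms are summable; this gives a
  pointwise limit. Fatou's lemma, applied to the distances from a fixed member of the sequence,
  shows that it is also the limit in the mean.
\<close>

lemma L2_torus_complete:
  assumes F: "\<And>n. F n \<in> L2_torus"
    and Cauchy: "\<And>e. e > 0 \<Longrightarrow> \<exists>N. \<forall>m\<ge>N. \<forall>n\<ge>N. norm_torus (\<lambda>x. F m x - F n x) < e"
  obtains g where "g \<in> L2_torus" "(\<lambda>n. norm_torus (\<lambda>x. F n x - g x)) \<longlonglongrightarrow> 0"
proof -
  have "\<forall>k. \<exists>N. \<forall>m\<ge>N. \<forall>n\<ge>N. norm_torus (\<lambda>x. F m x - F n x) < (1/2) ^ k"
    using Cauchy by simp
  then obtain N where N: "\<And>k m n. m \<ge> N k \<Longrightarrow> n \<ge> N k \<Longrightarrow> norm_torus (\<lambda>x. F m x - F n x) < (1/2) ^ k"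
    by metis
  \<comment> \<open>summing the thresholds makes the subsequence monotone, and adding \<open>k\<close> makes it unbounded\<close>
  define r where "r k = (\<Sum>i\<le>k. N i) + k" for k
  have rN: "N k \<le> r k" for k
    unfolding r_def using member_le_sum[of k "{..k}" N] by simp
  have r_Suc: "r k \<le> r (Suc k)" for k
    by (simp add: r_def)
  have rk: "k \<le> r k" for k by (simp add: r_def)
  define d where "d k x = F (r (Suc k)) x - F (r k) x" for k x
  have dL2: "d k \<in> L2_torus" for k
    unfolding d_def[abs_def] using F by auto
  have dnorm: "norm_torus (d k) < (1/2) ^ k" for k
    unfolding d_def[abs_def] using rN[of k] r_Suc[of k] by (intro N) auto
  have [measurable]: "F n \<in> borel_measurable torus" "d n \<in> borel_measurable torus" for n
    using F dL2 by (auto simp: L2_torus_def)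
  have "(\<integral>\<^sup>+x. (\<Sum>k. ennreal (cmod (d k x))) \<partial>torus) = (\<Sum>k. \<integral>\<^sup>+x. ennreal (cmod (d k x)) \<partial>torus)"
    by (rule nn_integral_suminf) measurable
  also have "\<dots> \<le> (\<Sum>k. ennreal ((1/2) ^ k))"
  proof (rule suminf_le)
    fix k
    have "(\<integral>\<^sup>+x. ennreal (cmod (d k x)) \<partial>torus) = ennreal (LINT x|torus. cmod (d k x))"
      by (rule nn_integral_eq_integral) (use integral_norm_le_norm_torus(1)[OF dL2] in auto)
    also have "\<dots> \<le> ennreal ((1/2) ^ k)"
      using integral_norm_le_norm_torus(2)[OF dL2[of k]] dnorm[of k] by (intro ennreal_leI) simp
    finally show "(\<integral>\<^sup>+x. ennreal (cmod (d k x)) \<partial>torus) \<le> ennreal ((1/2) ^ k)" .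
  qed auto
  also have "\<dots> = ennreal (\<Sum>k. (1/2) ^ k)"
    by (rule suminf_ennreal2) (auto intro: summable_geometric)
  also have "\<dots> < \<infinity>" by simp
  finally have "AE x in torus. (\<Sum>k. ennreal (cmod (d k x))) \<noteq> \<infinity>"
    by (intro nn_integral_noteq_infinite) auto
  then have conv: "AE x in torus. convergent (\<lambda>k. F (r k) x)"
  proof eventually_elim
    case (elim x)
    have "summable (\<lambda>k. cmod (d k x))"
      by (rule summable_suminf_not_top) (use elim in auto)
    then have "summable (\<lambda>k. d k x)"
      by (rule summable_norm_cancel)
    then have "convergent (\<lambda>n. \<Sum>k<n. d k x)"
      by (simp add: summable_iff_convergent)
    then have "convergent (\<lambda>n. (\<Sum>k<n. d k x) + F (r 0) x)"
      by (intro convergent_add convergent_const)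
    moreover have "(\<Sum>k<n. d k x) + F (r 0) x = F (r n) x" for n
      unfolding d_def using sum_lessThan_telescope[of "\<lambda>k. F (r k) x" n] by simp
    ultimately show ?case by simp
  qed
  \<comment> \<open>\<open>lim\<close> has an arbitrary value on the null set of divergence, and is measurable nevertheless\<close>
  define g where "g x = lim (\<lambda>k. F (r k) x)" for x
  have gm [measurable]: "g \<in> borel_measurable torus"
    unfolding g_def[abs_def] by (rule borel_measurable_lim_metric) measurable
  have close: "(\<lambda>x. F n x - g x) \<in> L2_torus \<and> norm_torus (\<lambda>x. F n x - g x) \<le> e"
    if e: "e > 0" and K: "\<forall>m\<ge>K. \<forall>n\<ge>K. norm_torus (\<lambda>x. F m x - F n x) < e" and n: "n \<ge> K" for n K e
  proof -
    have "(\<integral>\<^sup>+x. ennreal ((cmod (F n x - g x))\<^sup>2) \<partial>torus)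
        = (\<integral>\<^sup>+x. liminf (\<lambda>k. ennreal ((cmod (F n x - F (r k) x))\<^sup>2)) \<partial>torus)"
    proof (rule nn_integral_cong_AE)
      show "AE x in torus. ennreal ((cmod (F n x - g x))\<^sup>2)
          = liminf (\<lambda>k. ennreal ((cmod (F n x - F (r k) x))\<^sup>2))"
        using conv
      proof eventually_elim
        case (elim x)
        then have "(\<lambda>k. F (r k) x) \<longlonglongrightarrow> g x"
          unfolding g_def by (simp add: convergent_LIMSEQ_iff)
        then have "(\<lambda>k. ennreal ((cmod (F n x - F (r k) x))\<^sup>2)) \<longlonglongrightarrow> ennreal ((cmod (F n x - g x))\<^sup>2)"
          by (intro tendsto_intros)
        then show ?case
          by (metis lim_imp_Liminf sequentially_bot)
      qed
    qed
    also have "\<dots> \<le> liminf (\<lambda>k. \<integral>\<^sup>+x. ennreal ((cmod (F n x - F (r k) x))\<^sup>2) \<partial>torus)"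
      by (rule nn_integral_liminf) measurable
    also have "\<dots> \<le> ennreal (e\<^sup>2)"
    proof (rule Liminf_le)
      show "\<forall>\<^sub>F k in sequentially. (\<integral>\<^sup>+x. ennreal ((cmod (F n x - F (r k) x))\<^sup>2) \<partial>torus) \<le> ennreal (e\<^sup>2)"
      proof (rule eventually_sequentiallyI)
        fix k assume "K \<le> k"
        then have "K \<le> r k" using rk[of k] by simp
        then have "norm_torus (\<lambda>x. F n x - F (r k) x) < e" using K n by blast
        then show "(\<integral>\<^sup>+x. ennreal ((cmod (F n x - F (r k) x))\<^sup>2) \<partial>torus) \<le> ennreal (e\<^sup>2)"
          using F by (subst nn_integral_square_eq_norm_torus) (auto intro!: ennreal_leI power_mono)
      qed
    qed simp
    finally show ?thesis
      using L2_and_norm_le_of_nn_integral[of "\<lambda>x. F n x - g x" e] e by auto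
  qed
  obtain K where "\<forall>m\<ge>K. \<forall>n\<ge>K. norm_torus (\<lambda>x. F m x - F n x) < 1"
    using Cauchy[of 1] by auto
  then have "(\<lambda>x. F K x - g x) \<in> L2_torus"
    using close[of 1 K K] by simp
  from L2_diff[OF F[of K] this] have "g \<in> L2_torus"
    by simp
  moreover have "(\<lambda>n. norm_torus (\<lambda>x. F n x - g x)) \<longlonglongrightarrow> 0"
  proof (rule LIMSEQ_I)
    fix e :: real assume e: "0 < e"
    obtain K where "\<forall>m\<ge>K. \<forall>n\<ge>K. norm_torus (\<lambda>x. F m x - F n x) < e / 2"
      using Cauchy[of "e / 2"] e by auto
    then have "norm_torus (\<lambda>x. F n x - g x) \<le> e / 2" if "n \<ge> K" for n
      using close[of "e / 2" K n] that e by simp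
    then show "\<exists>K. \<forall>n\<ge>K. norm (norm_torus (\<lambda>x. F n x - g x) - 0) < e"
      using e by (intro exI[of _ K]) (auto simp: abs_of_nonneg intro: le_less_trans[of _ "e / 2"])
  qed
  ultimately show thesis by (rule that)
qed

section \<open>Characters and Bessel's inequality\<close>

lemma borel_measurable_torus_iff:
  "f \<in> borel_measurable torus \<longleftrightarrow> f \<in> borel_measurable (lebesgue_on {0..<2*pi})"
  by (simp add: torus_def)

lemma continuous_measurable_torus:
  fixes f :: "real \<Rightarrow> complex"
  assumes "continuous_on UNIV f"
  shows "f \<in> borel_measurable torus"
  unfolding borel_measurable_torus_iff
  by (rule continuous_imp_measurable_on_sets_lebesgue[OF continuous_on_subset[OF assms]]) auto

lemma continuous_chr [continuous_intros]: "continuous_on A (chr k)"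
  unfolding chr_def[abs_def] by (intro continuous_intros)

lemma norm_chr [simp]: "cmod (chr k x) = 1"
  using norm_exp_i_times[of "x * of_int k"] by (simp add: chr_def mult.assoc)

lemma chr_L2 [simp, intro]: "chr k \<in> L2_torus"
  by (rule L2_bounded[where B = 1]) (auto intro: continuous_measurable_torus continuous_chr)

lemma L2_chr_sum [intro, simp]: "(\<lambda>x. \<Sum>k\<in>K. c k * chr k x) \<in> L2_torus"
  by (intro L2_sum L2_scale chr_L2)

lemma chr_0 [simp]: "chr 0 x = 1"
  by (simp add: chr_def)

lemma chr_mult: "chr j x * chr k x = chr (j + k) x"
  by (simp add: chr_def exp_add[symmetric] algebra_simps)

lemma cnj_chr: "cnj (chr k x) = chr (- k) x"
  by (simp add: chr_def exp_cnj)

lemma fourier_eq_inner: "fourier f k = inner_torus f (chr k)"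
  by (simp add: fourier_def inner_torus_def chr_def exp_cnj)

lemma integral_chr: "(LINT x|torus. chr k x) = (if k = 0 then 1 else 0)"
proof (cases "k = 0")
  case True
  then show ?thesis by (simp add: measure_torus)
next
  case False
  let ?F = "\<lambda>x. exp (\<i> * complex_of_real x * of_int k) / (\<i> * of_int k)"
  have "(chr k has_integral (?F (2*pi) - ?F 0)) {0..2*pi}"
  proof (rule fundamental_theorem_of_calculus)
    fix x :: real
    have "((\<lambda>z. exp (\<i> * z * of_int k) / (\<i> * of_int k)) has_field_derivative
        exp (\<i> * of_real x * of_int k)) (at (of_real x))"
      by (rule derivative_eq_intros refl | use False in simp)+
    from has_vector_derivative_real_field[OF this]
    show "(?F has_vector_derivative chr k x) (at x within {0..2*pi})"
      by (simp add: chr_def)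
  qed simp
  moreover have "exp (\<i> * complex_of_real (2*pi) * of_int k) = 1"
    using exp_integer_2pi[of "of_int k"] by (simp add: mult.commute mult.left_commute)
  ultimately have "(chr k has_integral 0) {0..2*pi}"
    by simp
  then have "(chr k has_integral 0) {0..<2*pi}"
    by (rule has_integral_spike_set_eq[THEN iffD1, rotated -1])
       (auto intro: negligible_subset[of "{2*pi}"])
  then have I: "integral {0..<2*pi} (chr k) = 0"
    by (rule integral_unique)
  have int: "integrable (lebesgue_on {0..<2*pi}) (chr k)"
  proof (rule finite_measure.integrable_const_bound[where B = 1])
    show "finite_measure (lebesgue_on {0..<2*pi})"
      by (rule finite_measureI) (simp add: emeasure_restrict_space)
    show "chr k \<in> borel_measurable (lebesgue_on {0..<2*pi})"
      using chr_L2[of k] by (simp add: L2_torus_def borel_measurable_torus_iff)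
  qed simp
  have "(LINT x|torus. chr k x) = (LINT x|lebesgue_on {0..<2*pi}. (1/(2*pi)) *\<^sub>R chr k x)"
    unfolding torus_def
    by (rule integral_density) (use int in auto)
  also have "\<dots> = (1/(2*pi)) *\<^sub>R integral {0..<2*pi} (chr k)"
    using int by (simp add: lebesgue_integral_eq_integral)
  finally show ?thesis
    using I False by simp
qed

lemma inner_chr: "inner_torus (chr j) (chr k) = (if j = k then 1 else 0)"
  by (simp add: inner_torus_def cnj_chr chr_mult integral_chr)

lemma norm_torus_chr_sum:
  assumes "finite K"
  shows "norm_torus (\<lambda>x. \<Sum>k\<in>K. c k * chr k x) = L2_set (\<lambda>k. cmod (c k)) K"
proof -
  have "complex_of_real ((norm_torus (\<lambda>x. \<Sum>k\<in>K. c k * chr k x))\<^sup>2) =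
      (\<Sum>j\<in>K. c j * (\<Sum>k\<in>K. cnj (c k) * (if j = k then 1 else 0)))"
    unfolding inner_self[symmetric]
    by (subst inner_sum_left) (auto intro!: sum.cong simp: inner_sum_right inner_chr)
  also have "\<dots> = (\<Sum>j\<in>K. c j * cnj (c j))"
    using assms by (simp add: sum.delta mult_delta_right)
  also have "\<dots> = of_real (\<Sum>j\<in>K. (cmod (c j))\<^sup>2)"
    by (simp only: complex_norm_square of_real_sum)
  finally have "(norm_torus (\<lambda>x. \<Sum>k\<in>K. c k * chr k x))\<^sup>2 = (\<Sum>j\<in>K. (cmod (c j))\<^sup>2)"
    by (simp only: of_real_eq_iff)
  then show ?thesis
    unfolding L2_set_def by (metis norm_torus_nonneg real_sqrt_unique)
qed

text \<open>
  Pairing \<open>f\<close> with its own partial Fourier sum \<open>p\<close> gives \<open>\<parallel>p\<parallel>\<^sup>2 = \<langle>f|p\<rangle> \<le> \<parallel>f\<parallel> \<parallel>p\<parallel>\<close>.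
\<close>

lemma Bessel:
  assumes "f \<in> L2_torus" "finite K"
  shows "L2_set (\<lambda>k. cmod (fourier f k)) K \<le> norm_torus f"
proof -
  define p where "p x = (\<Sum>k\<in>K. fourier f k * chr k x)" for x
  define s where "s = L2_set (\<lambda>k. cmod (fourier f k)) K"
  have p: "p \<in> L2_torus" unfolding p_def[abs_def] by (rule L2_chr_sum)
  have np: "norm_torus p = s"
    unfolding p_def[abs_def] s_def by (rule norm_torus_chr_sum[OF assms(2)])
  have "inner_torus f p = (\<Sum>k\<in>K. cnj (fourier f k) * fourier f k)"
    unfolding p_def[abs_def] by (subst inner_sum_right) (use assms in \<open>auto simp: fourier_eq_inner\<close>)
  also have "\<dots> = of_real (\<Sum>k\<in>K. (cmod (fourier f k))\<^sup>2)"
    by (simp only: complex_norm_square of_real_sum mult.commute)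
  also have "(\<Sum>k\<in>K. (cmod (fourier f k))\<^sup>2) = s\<^sup>2"
    unfolding s_def L2_set_def by (simp add: sum_nonneg)
  finally have "s\<^sup>2 \<le> norm_torus f * s"
    using Cauchy_Schwarz_torus[OF assms(1) p] np by (simp add: norm_power)
  moreover have "0 \<le> s" by (simp add: s_def L2_set_nonneg)
  ultimately show ?thesis
    unfolding s_def[symmetric] power2_eq_square
    by (cases "s = 0") (auto simp: mult_le_cancel_right)
qed

section \<open>Density of trigonometric polynomials\<close>

lemma trig_polynomials_chr: "(\<lambda>x. c * chr k x) \<in> trig_polynomials"
  unfolding trig_polynomials_def
  by (auto intro!: exI[of _ "{k}"] exI[of _ "\<lambda>_. c"])

lemma trig_polynomials_const: "(\<lambda>x. c) \<in> trig_polynomials"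
  using trig_polynomials_chr[of c 0] by simp

lemma trig_polynomials_add:
  assumes "p \<in> trig_polynomials" "q \<in> trig_polynomials"
  shows "(\<lambda>x. p x + q x) \<in> trig_polynomials"
proof -
  obtain K c L d where K: "finite K" "p = (\<lambda>x. \<Sum>k\<in>K. c k * chr k x)"
    and L: "finite L" "q = (\<lambda>x. \<Sum>k\<in>L. d k * chr k x)"
    using assms unfolding trig_polynomials_def by blast
  let ?e = "\<lambda>k. (if k \<in> K then c k else 0) + (if k \<in> L then d k else 0)"
  have "p x + q x = (\<Sum>k\<in>K \<union> L. ?e k * chr k x)" for x
  proof -
    have "(\<Sum>k\<in>K \<union> L. (if k \<in> K then c k else 0) * chr k x) = p x"
      unfolding K(2) using K(1) L(1) by (intro sum.mono_neutral_cong_right) auto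
    moreover have "(\<Sum>k\<in>K \<union> L. (if k \<in> L then d k else 0) * chr k x) = q x"
      unfolding L(2) using K(1) L(1) by (intro sum.mono_neutral_cong_right) auto
    ultimately show ?thesis
      by (simp add: distrib_right sum.distrib)
  qed
  then show ?thesis
    unfolding trig_polynomials_def using K(1) L(1)
    by (intro CollectI exI[of _ "K \<union> L"] exI[of _ ?e]) auto
qed

lemma trig_polynomials_sum:
  "(\<And>i. i \<in> I \<Longrightarrow> F i \<in> trig_polynomials) \<Longrightarrow> (\<lambda>x. \<Sum>i\<in>I. F i x) \<in> trig_polynomials"
  by (induction I rule: infinite_finite_induct)
     (auto intro: trig_polynomials_add trig_polynomials_const)

lemma trig_polynomials_mult:
  assumes "p \<in> trig_polynomials" "q \<in> trig_polynomials"
  shows "(\<lambda>x. p x * q x) \<in> trig_polynomials"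
proof -
  obtain K c L d where K: "p = (\<lambda>x. \<Sum>k\<in>K. c k * chr k x)"
    and L: "q = (\<lambda>x. \<Sum>k\<in>L. d k * chr k x)"
    using assms unfolding trig_polynomials_def by blast
  have "(\<lambda>x. p x * q x) = (\<lambda>x. \<Sum>j\<in>K. \<Sum>k\<in>L. (c j * d k) * chr (j + k) x)"
    unfolding K L sum_product by (auto simp: chr_mult[symmetric] mult_ac)
  then show ?thesis
    by (auto intro!: trig_polynomials_sum trig_polynomials_chr)
qed

lemma trig_polynomials_L2: "p \<in> trig_polynomials \<Longrightarrow> p \<in> L2_torus"
  unfolding trig_polynomials_def by auto

text \<open>
  On the circle a real-linear functional is a combination of cosine and sine, hence of the
  characters of frequency \<open>1\<close> and \<open>-1\<close>; closure under sums and products does the rest.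
\<close>

lemma trig_polynomial_real_polynomial:
  fixes p :: "complex \<Rightarrow> real"
  assumes "real_polynomial_function p"
  shows "(\<lambda>x. of_real (p (cis x))) \<in> trig_polynomials"
  using assms
proof induction
  case (linear f)
  then interpret bounded_linear f .
  have c: "chr 1 x = cis x" "chr (-1) x = cnj (cis x)" for x
    by (simp_all add: chr_def cis_conv_exp exp_cnj)
  have "complex_of_real (f (cis x))
      = (of_real (f 1) / 2 + of_real (f \<i>) / (2 * \<i>)) * chr 1 x
      + (of_real (f 1) / 2 - of_real (f \<i>) / (2 * \<i>)) * chr (-1) x" for x
  proof -
    have "cis x = cos x *\<^sub>R 1 + sin x *\<^sub>R \<i>"
      by (simp add: complex_eq_iff)
    then have "f (cis x) = cos x * f 1 + sin x * f \<i>"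
      by (metis add scaleR real_scaleR_def)
    then show ?thesis
      unfolding c by (simp add: complex_eq_iff field_simps)
  qed
  then show ?case
    by (auto intro: trig_polynomials_add trig_polynomials_chr)
next
  case (const c)
  show ?case by (rule trig_polynomials_const)
next
  case (add f g)
  then show ?case using trig_polynomials_add by fastforce
next
  case (mult f g)
  then show ?case using trig_polynomials_mult by fastforce
qed

lemma trig_polynomial_polynomial_function:
  fixes P :: "complex \<Rightarrow> complex"
  assumes "polynomial_function P"
  shows "(\<lambda>x. P (cis x)) \<in> trig_polynomials"
proof -
  have "real_polynomial_function (Re \<circ> P)" "real_polynomial_function (Im \<circ> P)"
    using assms bounded_linear_Re bounded_linear_Im unfolding polynomial_function_def by blast+
  note RI = this[THEN trig_polynomial_real_polynomial]
  have "(\<lambda>x. of_real ((Re \<circ> P) (cis x)) + \<i> * of_real ((Im \<circ> P) (cis x))) \<in> trig_polynomials"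
    by (intro trig_polynomials_add trig_polynomials_mult RI trig_polynomials_const)
  then show ?thesis
    by (simp add: complex_eq[symmetric])
qed

lemma AE_torus_negligible:
  assumes "negligible N"
  shows "AE x in torus. x \<notin> N"
proof -
  have "AE x in lebesgue. x \<notin> N"
    using assms by (intro AE_not_in) (simp add: negligible_iff_null_sets)
  then show ?thesis
    unfolding torus_def by (subst AE_density) (auto simp: AE_restrict_space_iff)
qed

lemma norm_torus_tendsto_0_dominated:
  assumes f: "f \<in> borel_measurable torus" and F: "\<And>n. F n \<in> borel_measurable torus"
    and lim: "AE x in torus. (\<lambda>n. F n x) \<longlonglongrightarrow> f x"
    and bound: "\<And>n x. cmod (f x - F n x) \<le> w x" and w: "integrable torus (\<lambda>x. (w x)\<^sup>2)"
  shows "(\<lambda>n. norm_torus (\<lambda>x. f x - F n x)) \<longlonglongrightarrow> 0"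
proof -
  have "(\<lambda>n. LINT x|torus. (cmod (f x - F n x))\<^sup>2) \<longlonglongrightarrow> (LINT x|torus. 0)"
  proof (rule integral_dominated_convergence[OF _ _ w])
    show "AE x in torus. (\<lambda>n. (cmod (f x - F n x))\<^sup>2) \<longlonglongrightarrow> 0"
      using lim
    proof eventually_elim
      case (elim x)
      have "(\<lambda>n. (cmod (f x - F n x))\<^sup>2) \<longlonglongrightarrow> (cmod (f x - f x))\<^sup>2"
        by (intro tendsto_intros elim)
      then show ?case by simp
    qed
    show "AE x in torus. norm ((cmod (f x - F n x))\<^sup>2) \<le> (w x)\<^sup>2" for n
      using bound by (intro AE_I2) (simp add: abs_of_nonneg power_mono)
  qed (use f F in measurable)
  then have "(\<lambda>n. sqrt (LINT x|torus. (cmod (f x - F n x))\<^sup>2)) \<longlonglongrightarrow> sqrt 0"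
    by (intro tendsto_real_sqrt) simp
  then show ?thesis by (simp add: norm_torus_def)
qed

text \<open>
  A function on the line becomes a function on the circle through the angle, which jumps at the
  point \<open>1\<close>. The cutoff vanishes there, and the bound on \<open>g\<close> makes the product tend to zero.
\<close>

lemma continuous_on_circle_cutoff:
  fixes g :: "real \<Rightarrow> complex"
  assumes g: "continuous_on UNIV g" and B: "\<And>t. cmod (g t) \<le> B" and n: "0 \<le> n"
  shows "continuous_on (sphere 0 1) (\<lambda>z. min 1 (n * cmod (z - 1)) *\<^sub>R g (Arg2pi z))"
  unfolding continuous_on_eq_continuous_within
proof
  fix z :: complex assume z: "z \<in> sphere 0 1"
  let ?\<phi> = "\<lambda>z. min 1 (n * cmod (z - 1)) *\<^sub>R g (Arg2pi z)"
  show "continuous (at z within sphere 0 1) ?\<phi>"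
  proof (cases "z = 1")
    case True
    have "((\<lambda>z. \<bar>B\<bar> * (n * cmod (z - 1))) \<longlongrightarrow> \<bar>B\<bar> * (n * cmod (1 - 1))) (at 1 within sphere 0 1)"
      by (intro tendsto_intros)
    then have lim0: "((\<lambda>z. \<bar>B\<bar> * (n * cmod (z - 1))) \<longlongrightarrow> 0) (at 1 within sphere 0 1)"
      by simp
    have "(?\<phi> \<longlongrightarrow> 0) (at 1 within sphere 0 1)"
    proof (rule Lim_null_comparison[OF always_eventually lim0], rule allI)
      fix z
      have "norm (?\<phi> z) \<le> (n * cmod (z - 1)) * \<bar>B\<bar>"
        unfolding norm_scaleR
        using n B[of "Arg2pi z"] by (intro mult_mono) (auto simp: abs_of_nonneg)
      then show "norm (?\<phi> z) \<le> \<bar>B\<bar> * (n * cmod (z - 1))"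
        by (simp add: mult.commute)
    qed
    then show ?thesis
      using True by (simp add: continuous_within)
  next
    case False
    have "z \<notin> \<real>\<^sub>\<ge>\<^sub>0"
    proof
      assume "z \<in> \<real>\<^sub>\<ge>\<^sub>0"
      then obtain r where "z = of_real r" "0 \<le> r" by (rule nonneg_Reals_cases)
      with z False show False by simp
    qed
    then have "isCont Arg2pi z"
      by (rule continuous_at_Arg2pi)
    then have "isCont (\<lambda>z. g (Arg2pi z)) z"
      by (rule isCont_o2) (use g in \<open>simp add: continuous_on_eq_continuous_at\<close>)
    moreover have "isCont (\<lambda>z. min 1 (n * cmod (z - 1))) z"
      by (intro continuous_min continuous_intros)
    ultimately have "isCont ?\<phi> z"
      by (rule continuous_scaleR[rotated])
    then show ?thesis
      by (rule continuous_at_imp_continuous_at_within)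
  qed
qed

lemma trig_polynomials_dense_continuous_circle:
  fixes \<phi> :: "complex \<Rightarrow> complex"
  assumes \<phi>: "continuous_on (sphere 0 1) \<phi>" and e: "0 < e"
  shows "\<exists>p\<in>trig_polynomials. norm_torus (\<lambda>x. \<phi> (cis x) - p x) \<le> e"
proof -
  obtain P where P: "polynomial_function P" "\<And>z. z \<in> sphere 0 1 \<Longrightarrow> norm (\<phi> z - P z) < e"
    using Stone_Weierstrass_polynomial_function[OF compact_sphere \<phi> e] by blast
  let ?p = "\<lambda>x. P (cis x)"
  have p: "?p \<in> trig_polynomials"
    by (rule trig_polynomial_polynomial_function[OF P(1)])
  have le: "cmod (\<phi> (cis x) - ?p x) \<le> e" for x
    using P(2)[of "cis x"] by simp
  have "continuous_on UNIV (\<lambda>x. \<phi> (cis x))"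
    by (rule continuous_on_compose2[OF \<phi>]) (auto intro!: continuous_intros)
  then have m: "(\<lambda>x. \<phi> (cis x) - ?p x) \<in> borel_measurable torus"
    using continuous_measurable_torus trig_polynomials_L2[OF p] by (auto simp: L2_torus_def)
  have "norm_torus (\<lambda>x. \<phi> (cis x) - ?p x) \<le> e"
  proof (rule L2_and_norm_le_of_nn_integral(2)[OF m])
    have "(\<integral>\<^sup>+x. ennreal ((cmod (\<phi> (cis x) - ?p x))\<^sup>2) \<partial>torus) \<le> (\<integral>\<^sup>+x. ennreal (e\<^sup>2) \<partial>torus)"
      using le by (intro nn_integral_mono ennreal_leI power_mono) auto
    then show "(\<integral>\<^sup>+x. ennreal ((cmod (\<phi> (cis x) - ?p x))\<^sup>2) \<partial>torus) \<le> ennreal (e\<^sup>2)"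
      by (simp add: emeasure_torus)
  qed (use e in simp)
  then show ?thesis by (rule bexI[OF _ p])
qed

text \<open>
  A measurable function is almost everywhere a limit of continuous functions on the line. Projecting
  their values to the ball of radius \<open>B\<close> and cutting off near the point \<open>1\<close> of the circle keeps this
  limit and makes them uniformly bounded continuous functions on the circle; dominated convergence
  gives approximation in the mean, and Stone-Weierstrass replaces them by trigonometric polynomials.
\<close>

lemma trig_polynomials_dense_bounded:
  assumes f: "f \<in> borel_measurable torus" and B: "\<And>x. cmod (f x) \<le> B" and e: "0 < e"
  shows "\<exists>p\<in>trig_polynomials. norm_torus (\<lambda>x. f x - p x) < e"
proof -
  have B0: "0 \<le> B" using B[of 0] norm_ge_zero order_trans by blast
  let ?S = "{0..<2*pi}"
  have "(\<lambda>x. if x \<in> ?S then f x else 0) \<in> borel_measurable lebesgue"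
    using f unfolding borel_measurable_torus_iff by (rule borel_measurable_if_I) simp
  then have "(\<lambda>x. if x \<in> ?S then f x else 0) measurable_on UNIV"
    by (rule lebesgue_measurable_imp_measurable_on) simp
  then obtain N g where N: "negligible N" and g: "\<And>n. continuous_on UNIV (g n)"
    and lim: "\<And>x. x \<notin> N \<Longrightarrow> (\<lambda>n. g n x) \<longlonglongrightarrow> (if x \<in> ?S then f x else 0)"
    unfolding measurable_on_def by auto
  define c :: "complex \<Rightarrow> complex" where "c = closest_point (cball 0 B)"
  have cc: "continuous_on UNIV c"
    unfolding c_def using B0 by (intro continuous_on_closest_point) auto
  have cB: "cmod (c z) \<le> B" for z
    using closest_point_in_set[of "cball 0 B" z] B0 by (simp add: c_def)
  have cid: "c z = z" if "cmod z \<le> B" for z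
    using that by (simp add: c_def closest_point_self)
  have cg: "continuous_on UNIV (\<lambda>x. c (g n x))" for n
    by (rule continuous_on_compose2[OF cc g]) simp
  define \<phi> where "\<phi> n z = min 1 (real n * cmod (z - 1)) *\<^sub>R c (g n (Arg2pi z))" for n z
  have \<phi>: "continuous_on (sphere 0 1) (\<phi> n)" for n
    unfolding \<phi>_def[abs_def] by (rule continuous_on_circle_cutoff[OF cg cB]) simp
  have \<phi>m: "(\<lambda>x. \<phi> n (cis x)) \<in> borel_measurable torus" for n
    by (rule continuous_measurable_torus, rule continuous_on_compose2[OF \<phi>])
       (auto intro!: continuous_intros)
  have \<phi>B: "cmod (\<phi> n z) \<le> 1 * B" for n z
    unfolding \<phi>_def norm_scaleR by (intro mult_mono cB) auto
  \<comment> \<open>the origin corresponds to the point where every cutoff vanishes\<close>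
  have AE1: "AE x in torus. x \<notin> N \<union> {0}"
    using N by (intro AE_torus_negligible negligible_Un) auto
  have AE2: "AE x in torus. x \<in> ?S"
    using AE_space[of torus] by (simp add: space_torus)
  have "(\<lambda>n. norm_torus (\<lambda>x. f x - \<phi> n (cis x))) \<longlonglongrightarrow> 0"
  proof (rule norm_torus_tendsto_0_dominated[OF f \<phi>m, where w = "\<lambda>_. B + B"])
    show "AE x in torus. (\<lambda>n. \<phi> n (cis x)) \<longlonglongrightarrow> f x"
      using AE1 AE2
    proof eventually_elim
      case (elim x)
      have x: "0 < x" "x < 2 * pi" using elim by auto
      have A: "Arg2pi (cis x) = x"
        using x Arg2pi_exp[of "\<i> * of_real x"] by (simp add: cis_conv_exp)
      have "cis x \<noteq> 1"
        using A x by (auto simp: Arg2pi_of_real[of 1, simplified])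
      then have d: "0 < cmod (cis x - 1)" by simp
      have "(\<lambda>n. g n x) \<longlonglongrightarrow> f x" using lim[of x] elim by auto
      then have "(\<lambda>n. c (g n x)) \<longlonglongrightarrow> c (f x)"
        using cc by (intro continuous_on_tendsto_compose[OF cc]) auto
      then have 1: "(\<lambda>n. c (g n x)) \<longlonglongrightarrow> f x"
        using cid[OF B] by simp
      have "eventually (\<lambda>n. \<phi> n (cis x) = c (g n x)) sequentially"
      proof -
        obtain M where M: "1 < real M * cmod (cis x - 1)"
          using reals_Archimedean3[OF d] by blast
        show ?thesis
        proof (rule eventually_sequentiallyI[of M])
          fix n assume "M \<le> n"
          then have "real M * cmod (cis x - 1) \<le> real n * cmod (cis x - 1)"
            by (intro mult_right_mono) auto
          with M show "\<phi> n (cis x) = c (g n x)"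
            by (simp add: \<phi>_def A)
        qed
      qed
      then show ?case
        using 1 by (simp add: tendsto_cong)
    qed
    show "cmod (f x - \<phi> n (cis x)) \<le> B + B" for n x
      using norm_triangle_ineq4[of "f x" "\<phi> n (cis x)"] B[of x] \<phi>B[of n "cis x"] by simp
  qed simp
  then have "eventually (\<lambda>n. norm_torus (\<lambda>x. f x - \<phi> n (cis x)) < e / 2) sequentially"
    using e by (intro order_tendstoD) auto
  then obtain n where n: "norm_torus (\<lambda>x. f x - \<phi> n (cis x)) < e / 2"
    by (auto simp: eventually_sequentially)
  obtain p where p: "p \<in> trig_polynomials" "norm_torus (\<lambda>x. \<phi> n (cis x) - p x) \<le> e / 2"
    using trig_polynomials_dense_continuous_circle[OF \<phi>, of "e / 2" n] e by auto
  have "norm_torus (\<lambda>x. f x - p x)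
      \<le> norm_torus (\<lambda>x. f x - \<phi> n (cis x)) + norm_torus (\<lambda>x. \<phi> n (cis x) - p x)"
    by (rule norm_torus_triangle_diff)
       (use L2_bounded[OF f B] L2_bounded[OF \<phi>m \<phi>B] trig_polynomials_L2[OF p(1)] in auto)
  with n p show ?thesis by (intro bexI[of _ p]) auto
qed

text \<open>
  Truncating the large values reduces the claim to bounded functions.
\<close>

lemma trig_polynomials_dense:
  assumes f: "f \<in> L2_torus" and e: "0 < e"
  shows "\<exists>p\<in>trig_polynomials. norm_torus (\<lambda>x. f x - p x) < e"
proof -
  have fm [measurable]: "f \<in> borel_measurable torus" using f by (simp add: L2_torus_def)
  define F where "F n x = (if cmod (f x) \<le> real n then f x else 0)" for n x
  have Fm [measurable]: "F n \<in> borel_measurable torus" for n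
    unfolding F_def[abs_def] by measurable
  have "(\<lambda>n. norm_torus (\<lambda>x. f x - F n x)) \<longlonglongrightarrow> 0"
  proof (rule norm_torus_tendsto_0_dominated[OF fm Fm, where w = "\<lambda>x. cmod (f x)"])
    show "AE x in torus. (\<lambda>n. F n x) \<longlonglongrightarrow> f x"
    proof (rule AE_I2)
      fix x
      obtain M where "cmod (f x) \<le> real M" using real_arch_simple by blast
      then have "eventually (\<lambda>n. F n x = f x) sequentially"
        by (intro eventually_sequentiallyI[of M]) (auto simp: F_def)
      then show "(\<lambda>n. F n x) \<longlonglongrightarrow> f x"
        by (simp add: tendsto_eventually)
    qed
    show "cmod (f x - F n x) \<le> cmod (f x)" for n x by (simp add: F_def)
    show "integrable torus (\<lambda>x. (cmod (f x))\<^sup>2)" using f by (simp add: L2_torus_def)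
  qed
  then have "eventually (\<lambda>n. norm_torus (\<lambda>x. f x - F n x) < e / 2) sequentially"
    using e by (intro order_tendstoD) auto
  then obtain n where n: "norm_torus (\<lambda>x. f x - F n x) < e / 2"
    by (auto simp: eventually_sequentially)
  have B: "cmod (F n x) \<le> real n" for x by (simp add: F_def)
  obtain p where p: "p \<in> trig_polynomials" "norm_torus (\<lambda>x. F n x - p x) < e / 2"
    using trig_polynomials_dense_bounded[OF Fm B, of "e / 2"] e by auto
  have "norm_torus (\<lambda>x. f x - p x)
      \<le> norm_torus (\<lambda>x. f x - F n x) + norm_torus (\<lambda>x. F n x - p x)"
    by (rule norm_torus_triangle_diff)
       (use f L2_bounded[OF Fm B] trig_polynomials_L2[OF p(1)] in auto)
  with n p show ?thesis by (intro bexI[of _ p]) auto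
qed

section \<open>Gram sections and synthesis operators\<close>

text \<open>
  The supremum of reals that defines the norm of a section is meaningful only because matrices of
  finite size are bounded; the crude bound by the sum of all entries suffices.
\<close>

lemma section_norm_bdd_above:
  "bdd_above {L2_set (\<lambda>j. cmod (\<Sum>k\<in>{- int n..int n}. M j k * v k)) {- int n..int n} | v.
          L2_set (\<lambda>k. cmod (v k)) {- int n..int n} \<le> 1}"
proof (rule bdd_aboveI, clarify)
  fix v assume v: "L2_set (\<lambda>k. cmod (v k)) {- int n..int n} \<le> 1"
  have v1: "cmod (v k) \<le> 1" if "k \<in> {- int n..int n}" for k
    using member_le_L2_set[OF _ that, of "\<lambda>k. cmod (v k)"] v by simp
  have "L2_set (\<lambda>j. cmod (\<Sum>k\<in>{- int n..int n}. M j k * v k)) {- int n..int n}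
      \<le> (\<Sum>j\<in>{- int n..int n}. cmod (\<Sum>k\<in>{- int n..int n}. M j k * v k))"
    by (rule L2_set_le_sum) simp
  also have "\<dots> \<le> (\<Sum>j\<in>{- int n..int n}. \<Sum>k\<in>{- int n..int n}. cmod (M j k))"
    by (intro sum_mono sum_norm_le) (auto simp: norm_mult intro!: mult_left_le v1)
  finally show "L2_set (\<lambda>j. cmod (\<Sum>k\<in>{- int n..int n}. M j k * v k)) {- int n..int n}
      \<le> (\<Sum>j\<in>{- int n..int n}. \<Sum>k\<in>{- int n..int n}. cmod (M j k))" .
qed

lemma section_norm_upper:
  assumes "L2_set (\<lambda>k. cmod (v k)) {- int n..int n} \<le> 1"
  shows "L2_set (\<lambda>j. cmod (\<Sum>k\<in>{- int n..int n}. M j k * v k)) {- int n..int n} \<le> section_norm n M"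
  unfolding section_norm_def
  by (rule cSup_upper[OF _ section_norm_bdd_above], rule CollectI, rule exI[of _ v])
     (simp add: assms)

lemma section_norm_least:
  assumes "\<And>v. L2_set (\<lambda>k. cmod (v k)) {- int n..int n} \<le> 1 \<Longrightarrow>
      L2_set (\<lambda>j. cmod (\<Sum>k\<in>{- int n..int n}. M j k * v k)) {- int n..int n} \<le> B"
  shows "section_norm n M \<le> B"
  unfolding section_norm_def
proof (rule cSup_least)
  show "{L2_set (\<lambda>j. cmod (\<Sum>k\<in>{- int n..int n}. M j k * v k)) {- int n..int n} | v.
      L2_set (\<lambda>k. cmod (v k)) {- int n..int n} \<le> 1} \<noteq> {}"
    (is "?A \<noteq> {}")
  proof -
    have "L2_set (\<lambda>j. cmod (\<Sum>k\<in>{- int n..int n}. M j k * 0)) {- int n..int n} \<in> ?A"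
      by (rule CollectI, rule exI[of _ "\<lambda>_. 0"]) (simp add: L2_set_def)
    then show ?thesis by (metis empty_iff)
  qed
next
  fix r
  assume "r \<in> {L2_set (\<lambda>j. cmod (\<Sum>k\<in>{- int n..int n}. M j k * v k)) {- int n..int n} | v.
      L2_set (\<lambda>k. cmod (v k)) {- int n..int n} \<le> 1}"
  then show "r \<le> B" using assms by (elim CollectE exE conjE) simp
qed

lemma section_norm_nonneg: "0 \<le> section_norm n M"
proof -
  have "L2_set (\<lambda>k. cmod ((\<lambda>_. 0) k)) {- int n..int n} \<le> 1"
    by (simp add: L2_set_def)
  from section_norm_upper[OF this] show ?thesis
    by (rule order_trans[OF L2_set_nonneg])
qed

lemma section_norm_apply:
  "L2_set (\<lambda>j. cmod (\<Sum>k\<in>{- int n..int n}. M j k * v k)) {- int n..int n}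
    \<le> section_norm n M * L2_set (\<lambda>k. cmod (v k)) {- int n..int n}"
proof -
  let ?K = "{- int n..int n}"
  define s where "s = L2_set (\<lambda>k. cmod (v k)) ?K"
  have s0: "0 \<le> s" by (simp add: s_def L2_set_nonneg)
  show ?thesis
  proof (cases "s = 0")
    case True
    then have "v k = 0" if "k \<in> ?K" for k
      using that by (simp add: s_def L2_set_eq_0_iff)
    then show ?thesis
      by (simp add: L2_set_def)
  next
    case False
    with s0 have s: "0 < s" by simp
    let ?w = "\<lambda>k. v k / of_real s"
    have scale: "L2_set (\<lambda>k. cmod (z k / of_real s)) ?K = L2_set (\<lambda>k. cmod (z k)) ?K / s"
      for z :: "int \<Rightarrow> complex"
    proof -
      have "L2_set (\<lambda>k. cmod (z k / of_real s)) ?K = L2_set (\<lambda>k. (1 / s) * cmod (z k)) ?K"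
        using s by (simp add: norm_divide)
      also have "\<dots> = (1 / s) * L2_set (\<lambda>k. cmod (z k)) ?K"
        using s by (intro L2_set_right_distrib[symmetric]) simp
      finally show ?thesis by simp
    qed
    have "L2_set (\<lambda>k. cmod (?w k)) ?K \<le> 1"
      unfolding scale s_def[symmetric] using s by simp
    then have "L2_set (\<lambda>j. cmod (\<Sum>k\<in>?K. M j k * ?w k)) ?K \<le> section_norm n M"
      by (rule section_norm_upper)
    also have "L2_set (\<lambda>j. cmod (\<Sum>k\<in>?K. M j k * ?w k)) ?K
        = L2_set (\<lambda>j. cmod (\<Sum>k\<in>?K. M j k * v k)) ?K / s"
      unfolding scale[symmetric] by (simp add: sum_divide_distrib)
    finally show ?thesis
      unfolding s_def[symmetric] using s by (simp only: pos_divide_le_eq)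
  qed
qed

lemma inner_synthesis:
  assumes u: "\<And>k. u k \<in> L2_torus"
  shows "inner_torus (\<lambda>x. \<Sum>k\<in>K. v k * u k x) (\<lambda>x. \<Sum>j\<in>K. w j * u j x)
    = (\<Sum>j\<in>K. cnj (w j) * (\<Sum>k\<in>K. inner_torus (u k) (u j) * v k))"
proof -
  have "(\<lambda>x. \<Sum>k\<in>K. v k * u k x) \<in> L2_torus"
    by (intro L2_sum L2_scale u)
  then show ?thesis
    by (subst inner_sum_right) (simp_all add: u inner_sum_left mult.commute)
qed

text \<open>
  This is \<open>\<parallel>U\<^sup>* U\<parallel> \<le> \<parallel>U\<parallel>\<^sup>2\<close>: for \<open>w = U\<^sup>* U v\<close> one has
  \<open>\<parallel>w\<parallel>\<^sup>2 = \<langle>U v | U w\<rangle> \<le> C\<^sup>2 \<parallel>v\<parallel> \<parallel>w\<parallel>\<close>.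
\<close>

lemma section_norm_gram_le:
  assumes u: "\<And>k. u k \<in> L2_torus" and C: "0 \<le> C"
    and le: "\<And>v. norm_torus (\<lambda>x. \<Sum>k\<in>{- int n..int n}. v k * u k x)
        \<le> C * L2_set (\<lambda>k. cmod (v k)) {- int n..int n}"
  shows "section_norm n (\<lambda>j k. inner_torus (u k) (u j)) \<le> C\<^sup>2"
proof (rule section_norm_least)
  let ?K = "{- int n..int n}"
  fix v assume v: "L2_set (\<lambda>k. cmod (v k)) ?K \<le> 1"
  define w where "w j = (\<Sum>k\<in>?K. inner_torus (u k) (u j) * v k)" for j
  define s where "s = L2_set (\<lambda>j. cmod (w j)) ?K"
  have s0: "0 \<le> s" by (simp add: s_def L2_set_nonneg)
  let ?U = "\<lambda>v x. \<Sum>k\<in>?K. v k * u k x"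
  have UL2: "?U v \<in> L2_torus" for v
    by (intro L2_sum L2_scale u)
  have "inner_torus (?U v) (?U w) = (\<Sum>j\<in>?K. cnj (w j) * w j)"
    unfolding inner_synthesis[OF u] w_def[symmetric] ..
  also have "\<dots> = of_real (\<Sum>j\<in>?K. (cmod (w j))\<^sup>2)"
    by (simp only: complex_norm_square of_real_sum mult.commute)
  also have "(\<Sum>j\<in>?K. (cmod (w j))\<^sup>2) = s\<^sup>2"
    unfolding s_def L2_set_def by (simp add: sum_nonneg)
  finally have "s\<^sup>2 = cmod (inner_torus (?U v) (?U w))"
    by (simp add: norm_power)
  also have "\<dots> \<le> norm_torus (?U v) * norm_torus (?U w)"
    by (rule Cauchy_Schwarz_torus[OF UL2 UL2])
  also have "\<dots> \<le> (C * 1) * (C * s)"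
  proof (rule mult_mono)
    show "norm_torus (?U v) \<le> C * 1"
      using le[of v] mult_left_mono[OF v C] by simp
    show "norm_torus (?U w) \<le> C * s"
      unfolding s_def by (rule le)
  qed (use C in auto)
  finally have "s * s \<le> C\<^sup>2 * s"
    by (simp add: power2_eq_square mult.assoc)
  then have "s \<le> C\<^sup>2"
    using s0 by (cases "s = 0") (auto simp: mult_le_cancel_right)
  then show "L2_set (\<lambda>j. cmod (\<Sum>k\<in>?K. inner_torus (u k) (u j) * v k)) ?K \<le> C\<^sup>2"
    by (simp add: s_def w_def)
qed

text \<open>
  This is \<open>\<parallel>U\<parallel>\<^sup>2 \<le> \<parallel>U\<^sup>* U\<parallel>\<close>, from \<open>\<parallel>U v\<parallel>\<^sup>2 = \<langle>U\<^sup>* U v | v\<rangle>\<close>.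
\<close>

lemma norm_synthesis_le_section:
  assumes u: "\<And>k. u k \<in> L2_torus"
    and B: "section_norm n (\<lambda>j k. inner_torus (u k) (u j)) \<le> B"
  shows "norm_torus (\<lambda>x. \<Sum>k\<in>{- int n..int n}. v k * u k x)
      \<le> sqrt B * L2_set (\<lambda>k. cmod (v k)) {- int n..int n}"
proof -
  let ?K = "{- int n..int n}"
  let ?U = "\<lambda>x. \<Sum>k\<in>?K. v k * u k x"
  define w where "w j = (\<Sum>k\<in>?K. inner_torus (u k) (u j) * v k)" for j
  define s where "s = L2_set (\<lambda>k. cmod (v k)) ?K"
  have s0: "0 \<le> s" by (simp add: s_def L2_set_nonneg)
  have "(norm_torus ?U)\<^sup>2 = cmod (inner_torus ?U ?U)"
    by (simp add: inner_self norm_power)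
  also have "\<dots> = cmod (\<Sum>j\<in>?K. cnj (v j) * w j)"
    unfolding inner_synthesis[OF u] w_def ..
  also have "\<dots> \<le> (\<Sum>j\<in>?K. \<bar>cmod (v j)\<bar> * \<bar>cmod (w j)\<bar>)"
    by (rule sum_norm_le) (simp add: norm_mult)
  also have "\<dots> \<le> s * L2_set (\<lambda>j. cmod (w j)) ?K"
    unfolding s_def by (rule L2_set_mult_ineq)
  also have "\<dots> \<le> s * (section_norm n (\<lambda>j k. inner_torus (u k) (u j)) * s)"
    unfolding s_def w_def by (intro mult_left_mono section_norm_apply L2_set_nonneg)
  also have "\<dots> \<le> s * (B * s)"
    by (intro mult_left_mono mult_right_mono B s0)
  also have "\<dots> = (sqrt B * s)\<^sup>2"
    using section_norm_nonneg[of n "\<lambda>j k. inner_torus (u k) (u j)"] B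
    by (simp add: power_mult_distrib power2_eq_square)
  finally show ?thesis
    unfolding s_def[symmetric]
    by (rule power2_le_imp_le)
       (use s0 section_norm_nonneg[of n "\<lambda>j k. inner_torus (u k) (u j)"] B in simp)
qed

lemma finite_subset_symmetric_interval:
  assumes "finite K"
  shows "\<exists>M. \<forall>N\<ge>M. K \<subseteq> {- int N..int N}"
proof -
  define M where "M = nat (\<Sum>k\<in>K. \<bar>k\<bar>)"
  have le: "\<bar>k\<bar> \<le> int M" if "k \<in> K" for k
    using member_le_sum[OF that, of abs] assms by (simp add: M_def sum_nonneg)
  have "K \<subseteq> {- int N..int N}" if N: "M \<le> N" for N
  proof
    fix k assume "k \<in> K"
    then have "\<bar>k\<bar> \<le> int N"
      using le[of k] N by linarith
    then show "k \<in> {- int N..int N}"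
      by (simp add: abs_le_iff)
  qed
  then show ?thesis by blast
qed

lemma norm_synthesis_le:
  assumes u: "\<And>k. u k \<in> L2_torus"
    and B: "\<And>n. section_norm n (\<lambda>j k. inner_torus (u k) (u j)) \<le> B"
    and K: "finite K"
  shows "norm_torus (\<lambda>x. \<Sum>k\<in>K. v k * u k x) \<le> sqrt B * L2_set (\<lambda>k. cmod (v k)) K"
proof -
  obtain n where n: "\<And>N. n \<le> N \<Longrightarrow> K \<subseteq> {- int N..int N}"
    using finite_subset_symmetric_interval[OF K] by (elim exE) blast
  have sub: "K \<subseteq> {- int n..int n}"
    by (rule n) simp
  define w where "w k = (if k \<in> K then v k else 0)" for k
  have "(\<Sum>k\<in>{- int n..int n}. w k * u k x) = (\<Sum>k\<in>K. v k * u k x)" for x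
    by (rule sum.mono_neutral_cong_right) (use sub in \<open>auto simp: w_def\<close>)
  moreover have "L2_set (\<lambda>k. cmod (w k)) {- int n..int n} = L2_set (\<lambda>k. cmod (v k)) K"
    unfolding L2_set_def
    by (rule arg_cong[where f = sqrt], rule sum.mono_neutral_cong_right)
       (use sub in \<open>auto simp: w_def\<close>)
  ultimately show ?thesis
    using norm_synthesis_le_section[OF u B, where v = w and n = n] by simp
qed

lemma L2_limit_unique:
  assumes F: "\<And>n. F n \<in> L2_torus" and g: "g \<in> L2_torus" and h: "h \<in> L2_torus"
    and 1: "(\<lambda>n. norm_torus (\<lambda>x. F n x - g x)) \<longlonglongrightarrow> 0"
    and 2: "(\<lambda>n. norm_torus (\<lambda>x. F n x - h x)) \<longlonglongrightarrow> 0"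
  shows "AE x in torus. g x = h x"
proof -
  have "norm_torus (\<lambda>x. g x - h x) \<le> norm_torus (\<lambda>x. F n x - g x) + norm_torus (\<lambda>x. F n x - h x)" for n
    using norm_torus_triangle_diff[OF g F[of n] h] norm_torus_minus_commute[of g "F n"] by simp
  then have "norm_torus (\<lambda>x. g x - h x) \<le> 0 + 0"
    by (intro LIMSEQ_le_const[OF tendsto_add[OF 1 2]]) auto
  then have "norm_torus (\<lambda>x. g x - h x) = 0"
    by (simp add: order_antisym)
  from norm_torus_eq_0_imp_AE[OF L2_diff[OF g h] this] show ?thesis by simp
qed

definition synthesis_section :: "(int \<Rightarrow> real \<Rightarrow> complex) \<Rightarrow> nat \<Rightarrow> (real \<Rightarrow> complex) \<Rightarrow> real \<Rightarrow> complex" where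
  "synthesis_section u N f x = (\<Sum>k\<in>{- int N..int N}. fourier f k * u k x)"

lemma synthesis_section_L2: "(\<And>k. u k \<in> L2_torus) \<Longrightarrow> synthesis_section u N f \<in> L2_torus"
  unfolding synthesis_section_def[abs_def] by (intro L2_sum L2_scale)

text \<open>
  The distance of two sections is at most \<open>C\<close> times the \<open>\<ell>\<^sup>2\<close> norm of the Fourier coefficients in
  between, and these are square summable by Bessel's inequality.
\<close>

lemma synthesis_converges:
  assumes u: "\<And>k. u k \<in> L2_torus" and C: "0 \<le> C"
    and le: "\<And>K v. finite K \<Longrightarrow> norm_torus (\<lambda>x. \<Sum>k\<in>K. v k * u k x) \<le> C * L2_set (\<lambda>k. cmod (v k)) K"
    and f: "f \<in> L2_torus"
  shows "\<exists>g. g \<in> L2_torus \<and> (\<lambda>N. norm_torus (\<lambda>x. synthesis_section u N f x - g x)) \<longlonglongrightarrow> 0"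
proof -
  let ?K = "\<lambda>N. {- int N..int N}"
  define s where "s N = (\<Sum>k\<in>?K N. (cmod (fourier f k))\<^sup>2)" for N
  have diff: "(norm_torus (\<lambda>x. synthesis_section u m f x - synthesis_section u n f x))\<^sup>2 \<le> C\<^sup>2 * (s m - s n)"
    if "n \<le> m" for m n
  proof -
    let ?D = "?K m - ?K n"
    have sub: "?K n \<subseteq> ?K m" using that by auto
    have "synthesis_section u m f x - synthesis_section u n f x = (\<Sum>k\<in>?D. fourier f k * u k x)" for x
      unfolding synthesis_section_def by (subst sum_diff) (use sub in auto)
    then have "norm_torus (\<lambda>x. synthesis_section u m f x - synthesis_section u n f x)
        \<le> C * L2_set (\<lambda>k. cmod (fourier f k)) ?D"
      using le[of ?D "fourier f"] by simp
    then have "(norm_torus (\<lambda>x. synthesis_section u m f x - synthesis_section u n f x))\<^sup>2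
        \<le> (C * L2_set (\<lambda>k. cmod (fourier f k)) ?D)\<^sup>2"
      by (intro power_mono) auto
    also have "\<dots> = C\<^sup>2 * (\<Sum>k\<in>?D. (cmod (fourier f k))\<^sup>2)"
      by (simp add: power_mult_distrib L2_set_def sum_nonneg)
    also have "(\<Sum>k\<in>?D. (cmod (fourier f k))\<^sup>2) = s m - s n"
      unfolding s_def by (subst sum_diff) (use sub in auto)
    finally show ?thesis .
  qed
  have mono: "s n \<le> s m" if "n \<le> m" for m n
    unfolding s_def by (rule sum_mono2) (use that in auto)
  then have "incseq s"
    by (simp add: incseq_def)
  moreover have "s N \<le> (norm_torus f)\<^sup>2" for N
  proof -
    have "s N = (L2_set (\<lambda>k. cmod (fourier f k)) (?K N))\<^sup>2"
      by (simp add: s_def L2_set_def sum_nonneg)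
    also have "\<dots> \<le> (norm_torus f)\<^sup>2"
      by (intro power_mono Bessel f L2_set_nonneg) simp
    finally show ?thesis .
  qed
  ultimately obtain l where "s \<longlonglongrightarrow> l"
    using incseq_convergent[of s "(norm_torus f)\<^sup>2"] by blast
  then have "Cauchy s" by (simp add: LIMSEQ_imp_Cauchy)
  have "\<exists>N. \<forall>m\<ge>N. \<forall>n\<ge>N. norm_torus (\<lambda>x. synthesis_section u m f x - synthesis_section u n f x) < e"
    if e: "0 < e" for e
  proof -
    \<comment> \<open>adding one to the denominator covers the case \<open>C = 0\<close>\<close>
    have "0 < e\<^sup>2 / (C\<^sup>2 + 1)" using e by (simp add: add_nonneg_pos)
    then obtain N where N: "\<And>m n. m \<ge> N \<Longrightarrow> n \<ge> N \<Longrightarrow> \<bar>s m - s n\<bar> < e\<^sup>2 / (C\<^sup>2 + 1)"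
      using \<open>Cauchy s\<close> unfolding Cauchy_def dist_real_def by blast
    have main: "norm_torus (\<lambda>x. synthesis_section u m f x - synthesis_section u n f x) < e"
      if mn: "m \<ge> N" "n \<ge> N" "n \<le> m" for m n
    proof -
      have "(norm_torus (\<lambda>x. synthesis_section u m f x - synthesis_section u n f x))\<^sup>2 \<le> C\<^sup>2 * (s m - s n)"
        by (rule diff) (use mn in simp)
      also have "\<dots> \<le> (C\<^sup>2 + 1) * \<bar>s m - s n\<bar>"
        using mono[OF mn(3)] by (intro mult_mono) auto
      also have "\<dots> < (C\<^sup>2 + 1) * (e\<^sup>2 / (C\<^sup>2 + 1))"
        by (rule mult_strict_left_mono[OF N[OF mn(1,2)]]) (simp add: add_nonneg_pos)
      also have "\<dots> = e\<^sup>2"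
        using add_nonneg_pos[of "C\<^sup>2" 1] by simp
      finally show ?thesis
        by (rule power2_less_imp_less) (use e in simp)
    qed
    show ?thesis
    proof (intro exI[of _ N] allI impI)
      fix m n assume "N \<le> m" "N \<le> n"
      then show "norm_torus (\<lambda>x. synthesis_section u m f x - synthesis_section u n f x) < e"
        using main[of m n] main[of n m]
          norm_torus_minus_commute[of "synthesis_section u m f" "synthesis_section u n f"]
        by (cases "n \<le> m") auto
    qed
  qed
  from L2_torus_complete[OF synthesis_section_L2[OF u] this] show ?thesis
    by metis
qed

text \<open>
  Limits in the mean are determined only almost everywhere, so a representative is chosen.
\<close>

definition synthesis :: "(int \<Rightarrow> real \<Rightarrow> complex) \<Rightarrow> (real \<Rightarrow> complex) \<Rightarrow> real \<Rightarrow> complex" where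
  "synthesis u f = (SOME g. g \<in> L2_torus \<and> (\<lambda>N. norm_torus (\<lambda>x. synthesis_section u N f x - g x)) \<longlonglongrightarrow> 0)"

text \<open>
  Each section is linear exactly, and the bound by \<open>C\<close> holds for it by Bessel's inequality; both
  pass to the limit, linearity only almost everywhere because the representatives are chosen
  independently. The second part is the form in which the operator is compared with the original
  one on trigonometric polynomials, where the sections become stationary.
\<close>

lemma bounded_operator_synthesis:
  assumes u: "\<And>k. u k \<in> L2_torus" and C: "0 \<le> C"
    and le: "\<And>K v. finite K \<Longrightarrow> norm_torus (\<lambda>x. \<Sum>k\<in>K. v k * u k x) \<le> C * L2_set (\<lambda>k. cmod (v k)) K"
  shows "bounded_operator (synthesis u)"
    and "f \<in> L2_torus \<Longrightarrow> g \<in> L2_torus \<Longrightarrow> eventually (\<lambda>N. synthesis_section u N f = g) sequentially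
      \<Longrightarrow> AE x in torus. synthesis u f x = g x"
proof -
  let ?S = "synthesis_section u"
  note S = synthesis_section_L2[of u, OF u]
  have T: "synthesis u f \<in> L2_torus" "(\<lambda>N. norm_torus (\<lambda>x. ?S N f x - synthesis u f x)) \<longlonglongrightarrow> 0"
    if "f \<in> L2_torus" for f
    using someI_ex[OF synthesis_converges[OF u C le that]] unfolding synthesis_def by blast+
  show "bounded_operator (synthesis u)"
    unfolding bounded_operator_def
  proof (intro conjI ballI allI)
    fix f assume f: "f \<in> L2_torus"
    show "synthesis u f \<in> L2_torus" by (rule T[OF f])
    fix c :: complex
    have *: "norm_torus (\<lambda>x. ?S N (\<lambda>y. c * f y) x - c * synthesis u f x)
        = cmod c * norm_torus (\<lambda>x. ?S N f x - synthesis u f x)" for N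
      unfolding norm_torus_scale[symmetric]
      by (simp add: synthesis_section_def fourier_eq_inner inner_scale_left sum_distrib_left
          right_diff_distrib mult.assoc)
    have "(\<lambda>N. norm_torus (\<lambda>x. ?S N (\<lambda>y. c * f y) x - c * synthesis u f x)) \<longlonglongrightarrow> 0"
      unfolding * using tendsto_mult_left[OF T(2)[OF f], of "cmod c"] by simp
    then show "AE x in torus. synthesis u (\<lambda>y. c * f y) x = c * synthesis u f x"
      by (intro L2_limit_unique[OF S T(1) L2_scale[OF T(1)] T(2)] L2_scale f)
  next
    fix f g assume f: "f \<in> L2_torus" and g: "g \<in> L2_torus"
    have fg: "(\<lambda>y. f y + g y) \<in> L2_torus" using f g by (rule L2_add)
    have sum: "?S N (\<lambda>y. f y + g y) x = ?S N f x + ?S N g x" for N x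
      using f g by (simp add: synthesis_section_def fourier_eq_inner inner_add_left
          distrib_right sum.distrib)
    have "norm_torus (\<lambda>x. ?S N (\<lambda>y. f y + g y) x - (synthesis u f x + synthesis u g x))
        \<le> norm_torus (\<lambda>x. ?S N f x - synthesis u f x) + norm_torus (\<lambda>x. ?S N g x - synthesis u g x)" for N
      using norm_torus_triangle[OF L2_diff[OF S T(1)[OF f]] L2_diff[OF S T(1)[OF g]], of N f N g]
      by (simp add: sum algebra_simps)
    then have "(\<lambda>N. norm_torus (\<lambda>x. ?S N (\<lambda>y. f y + g y) x - (synthesis u f x + synthesis u g x))) \<longlonglongrightarrow> 0"
      by (intro tendsto_sandwich[OF _ _ tendsto_const tendsto_add_zero[OF T(2)[OF f] T(2)[OF g]]])
         auto
    then show "AE x in torus. synthesis u (\<lambda>y. f y + g y) x = synthesis u f x + synthesis u g x"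
      by (rule L2_limit_unique[OF S T(1)[OF fg] L2_add[OF T(1)[OF f] T(1)[OF g]] T(2)[OF fg]])
  next
    show "\<exists>C. \<forall>f\<in>L2_torus. norm_torus (synthesis u f) \<le> C * norm_torus f"
    proof (intro exI[of _ C] ballI)
      fix f assume f: "f \<in> L2_torus"
      have "norm_torus (synthesis u f) \<le> C * norm_torus f + norm_torus (\<lambda>x. ?S N f x - synthesis u f x)" for N
      proof -
        have "norm_torus (?S N f) \<le> C * L2_set (\<lambda>k. cmod (fourier f k)) {- int N..int N}"
          unfolding synthesis_section_def[abs_def] by (rule le) simp
        also have "\<dots> \<le> C * norm_torus f"
          by (intro mult_left_mono Bessel f C) simp
        finally show ?thesis
          using norm_torus_le_add_diff[OF T(1)[OF f] S[of N f]]
            norm_torus_minus_commute[of "synthesis u f" "?S N f"] by simp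
      qed
      then have "norm_torus (synthesis u f) \<le> C * norm_torus f + 0"
        by (intro LIMSEQ_le_const[OF tendsto_add[OF tendsto_const T(2)[OF f]]]) auto
      then show "norm_torus (synthesis u f) \<le> C * norm_torus f" by simp
    qed
  qed
  assume f: "f \<in> L2_torus" and g: "g \<in> L2_torus"
    and ev: "eventually (\<lambda>N. ?S N f = g) sequentially"
  have "(\<lambda>N. norm_torus (\<lambda>x. ?S N f x - g x)) \<longlonglongrightarrow> 0"
    by (rule tendsto_eventually) (use ev in eventually_elim, simp add: norm_torus_def)
  then show "AE x in torus. synthesis u f x = g x"
    by (rule L2_limit_unique[OF S T(1)[OF f] g T(2)[OF f]])
qed

section \<open>Pseudo-differential operators\<close>

text \<open>
  The image of the character of frequency \<open>k\<close> under the pseudo-differential operator.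
\<close>

definition twisted_symbol :: "(real \<Rightarrow> int \<Rightarrow> complex) \<Rightarrow> int \<Rightarrow> real \<Rightarrow> complex" where
  "twisted_symbol \<sigma> k x = \<sigma> x k * chr k x"

lemma twisted_symbol_L2:
  assumes "(\<lambda>x. \<sigma> x k) \<in> L2_torus"
  shows "twisted_symbol \<sigma> k \<in> L2_torus"
proof -
  have m: "(\<lambda>x. \<sigma> x k) \<in> borel_measurable torus" "chr k \<in> borel_measurable torus"
    using assms chr_L2[of k] by (auto simp: L2_torus_def)
  have "twisted_symbol \<sigma> k \<in> borel_measurable torus"
    unfolding twisted_symbol_def[abs_def] using m by measurable
  then show ?thesis
    using assms by (simp add: L2_torus_def twisted_symbol_def norm_mult)
qed

lemma gram_matrix_eq:
  "gram_matrix \<sigma> = (\<lambda>j k. inner_torus (twisted_symbol \<sigma> k) (twisted_symbol \<sigma> j))"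
  unfolding gram_matrix_def[abs_def] inner_commute_cnj[symmetric] twisted_symbol_def[abs_def] ..

lemma assoc_matrix_eq: "assoc_matrix \<sigma> j k = inner_torus (twisted_symbol \<sigma> k) (chr j)"
proof -
  have "twisted_symbol \<sigma> k x * cnj (chr j x) = \<sigma> x k * cnj (chr (j - k) x)" for x
    using chr_mult[of k x "- j"] by (simp add: twisted_symbol_def cnj_chr)
  then show ?thesis
    by (simp add: assoc_matrix_def fourier_eq_inner inner_torus_def)
qed

lemma fourier_chr_sum:
  assumes "finite K"
  shows "fourier (\<lambda>x. \<Sum>k\<in>K. c k * chr k x) j = (if j \<in> K then c j else 0)"
  using assms
  by (simp add: fourier_eq_inner inner_sum_left inner_chr mult_delta_right sum.delta)

lemma pdo_chr_sum:
  assumes "finite K"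
  shows "pdo \<sigma> (\<lambda>x. \<Sum>k\<in>K. c k * chr k x) = (\<lambda>x. \<Sum>k\<in>K. c k * twisted_symbol \<sigma> k x)"
proof
  fix x
  have "pdo \<sigma> (\<lambda>x. \<Sum>k\<in>K. c k * chr k x) x = (\<Sum>\<^sub>\<infinity>k\<in>K. c k * twisted_symbol \<sigma> k x)"
    unfolding pdo_def
    by (rule infsum_cong_neutral) (auto simp: fourier_chr_sum[OF assms] twisted_symbol_def)
  then show "pdo \<sigma> (\<lambda>x. \<Sum>k\<in>K. c k * chr k x) x = (\<Sum>k\<in>K. c k * twisted_symbol \<sigma> k x)"
    using assms by simp
qed

text \<open>
  Boundedness makes the set of which the operator norm is the supremum bounded above. The bound on
  the unit ball extends by homogeneity, except where \<open>\<parallel>f\<parallel> = 0\<close>, which is not excluded for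
  functions that vanish almost everywhere.
\<close>

lemma operator_norm_nonneg_and_bound:
  assumes A: "bounded_operator A"
  shows "0 \<le> operator_norm A"
    and "f \<in> L2_torus \<Longrightarrow> norm_torus (A f) \<le> operator_norm A * norm_torus f"
proof -
  obtain C where C: "\<And>f. f \<in> L2_torus \<Longrightarrow> norm_torus (A f) \<le> C * norm_torus f"
    using A unfolding bounded_operator_def by blast
  have AL2: "A f \<in> L2_torus" if "f \<in> L2_torus" for f
    using A that by (auto simp: bounded_operator_def)
  have upper: "norm_torus (A f) \<le> operator_norm A" if f: "f \<in> L2_torus" "norm_torus f \<le> 1" for f
    unfolding operator_norm_def
  proof (rule cSup_upper)
    show "bdd_above {norm_torus (A f) |f. f \<in> L2_torus \<and> norm_torus f \<le> 1}"
    proof (rule bdd_aboveI, clarify)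
      fix f assume f: "f \<in> L2_torus" "norm_torus f \<le> 1"
      have "norm_torus (A f) \<le> C * norm_torus f" by (rule C[OF f(1)])
      also have "\<dots> \<le> \<bar>C\<bar> * 1" by (rule mult_mono) (use f in auto)
      finally show "norm_torus (A f) \<le> \<bar>C\<bar>" by simp
    qed
  qed (use f in blast)
  have n0: "norm_torus (\<lambda>x. 0) = 0" by (simp add: norm_torus_def)
  have "norm_torus (A (\<lambda>x. 0)) \<le> operator_norm A"
    by (rule upper) (simp_all add: n0)
  then show "0 \<le> operator_norm A"
    using norm_torus_nonneg[of "A (\<lambda>x. 0)"] by linarith
  assume f: "f \<in> L2_torus"
  show "norm_torus (A f) \<le> operator_norm A * norm_torus f"
  proof (cases "norm_torus f = 0")
    case True
    then show ?thesis using C[OF f] by simp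
  next
    case False
    define t where "t = norm_torus f"
    have t: "0 < t" using False norm_torus_nonneg[of f] unfolding t_def by linarith
    have scale: "\<forall>c. \<forall>f\<in>L2_torus. AE x in torus. A (\<lambda>y. c * f y) x = c * A f x"
      using A by (simp add: bounded_operator_def)
    let ?c = "complex_of_real (1 / t)"
    have g: "(\<lambda>y. ?c * f y) \<in> L2_torus" by (rule L2_scale[OF f])
    have "norm_torus (\<lambda>y. ?c * f y) = 1"
      unfolding norm_torus_scale norm_of_real t_def[symmetric] using t by simp
    then have "norm_torus (A (\<lambda>y. ?c * f y)) \<le> operator_norm A"
      using upper[OF g] by simp
    also have "norm_torus (A (\<lambda>y. ?c * f y)) = norm_torus (\<lambda>x. ?c * A f x)"
      by (rule norm_torus_cong_AE[OF AL2[OF g] L2_scale[OF AL2[OF f]] bspec[OF spec[OF scale] f]])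
    also have "\<dots> = norm_torus (A f) / t"
      unfolding norm_torus_scale norm_of_real using t by simp
    finally show ?thesis
      unfolding t_def[symmetric] using t by (simp only: pos_divide_le_eq)
  qed
qed

text \<open>
  For \<open>\<parallel>f\<parallel> \<le> 1\<close> and a trigonometric polynomial \<open>p\<close> with \<open>\<parallel>f - p\<parallel> < e\<close>, additivity gives
  \<open>\<parallel>A f\<parallel> \<le> D \<parallel>p\<parallel> + \<parallel>A\<parallel> e \<le> D + (D + \<parallel>A\<parallel>) e\<close>.
\<close>

lemma operator_norm_le_of_dense:
  assumes A: "bounded_operator A" and D: "0 \<le> D"
    and trig: "\<And>p. p \<in> trig_polynomials \<Longrightarrow> norm_torus (A p) \<le> D * norm_torus p"
  shows "operator_norm A \<le> D"
  unfolding operator_norm_def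
proof (rule cSup_least)
  show "{norm_torus (A f) |f. f \<in> L2_torus \<and> norm_torus f \<le> 1} \<noteq> {}"
    by (auto intro!: exI[of _ "\<lambda>_. 0"] simp: norm_torus_def)
next
  fix r assume "r \<in> {norm_torus (A f) |f. f \<in> L2_torus \<and> norm_torus f \<le> 1}"
  then obtain f where r: "r = norm_torus (A f)" and f: "f \<in> L2_torus" and f1: "norm_torus f \<le> 1"
    by blast
  define C where "C = operator_norm A"
  note C0 = operator_norm_nonneg_and_bound(1)[OF A, folded C_def]
  note C = operator_norm_nonneg_and_bound(2)[OF A, folded C_def]
  have AL2: "A f \<in> L2_torus" if "f \<in> L2_torus" for f
    using A that by (auto simp: bounded_operator_def)
  have approx: "norm_torus (A f) \<le> D + (D + C) * e" if e: "0 < e" for e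
  proof -
    obtain p where p: "p \<in> trig_polynomials" and pe: "norm_torus (\<lambda>x. f x - p x) < e"
      using trig_polynomials_dense[OF f e] by blast
    have pL: "p \<in> L2_torus" by (rule trig_polynomials_L2[OF p])
    let ?d = "\<lambda>x. f x - p x"
    have d: "?d \<in> L2_torus" using f pL by (rule L2_diff)
    have add: "\<forall>f\<in>L2_torus. \<forall>g\<in>L2_torus. AE x in torus. A (\<lambda>y. f y + g y) x = A f x + A g x"
      using A by (simp add: bounded_operator_def)
    have "AE x in torus. A f x = A p x + A ?d x"
      using bspec[OF bspec[OF add pL] d] by simp
    then have "norm_torus (A f) = norm_torus (\<lambda>x. A p x + A ?d x)"
      by (rule norm_torus_cong_AE[OF AL2[OF f] L2_add[OF AL2[OF pL] AL2[OF d]]])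
    also have "\<dots> \<le> norm_torus (A p) + norm_torus (A ?d)"
      by (rule norm_torus_triangle[OF AL2[OF pL] AL2[OF d]])
    also have "\<dots> \<le> D * (1 + e) + C * e"
    proof (rule add_mono)
      have "norm_torus p \<le> 1 + e"
        using norm_torus_le_add_diff[OF pL f] norm_torus_minus_commute[of f p] f1 pe by simp
      then have "D * norm_torus p \<le> D * (1 + e)"
        using D by (rule mult_left_mono)
      then show "norm_torus (A p) \<le> D * (1 + e)"
        using trig[OF p] by linarith
      have "C * norm_torus ?d \<le> C * e"
        using pe C0 by (intro mult_left_mono) auto
      then show "norm_torus (A ?d) \<le> C * e"
        using C[OF d] by linarith
    qed
    finally show ?thesis by (simp add: algebra_simps)
  qed
  show "r \<le> D"
    unfolding r
  proof (rule field_le_epsilon)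
    fix e :: real assume e: "0 < e"
    \<comment> \<open>the summand one covers \<open>D = C = 0\<close>\<close>
    let ?e = "e / (D + C + 1)"
    have "0 < ?e" using e D C0 by simp
    moreover have "(D + C) * ?e \<le> e"
    proof -
      have "(D + C) * e \<le> e * (D + C + 1)"
        using e by (simp add: algebra_simps)
      then show ?thesis
        using D C0 by (simp add: pos_divide_le_eq)
    qed
    ultimately show "norm_torus (A f) \<le> D + e"
      using approx[of ?e] by linarith
  qed
qed

text \<open>
  The sequence is, up to conjugation, the adjoint of the synthesis map applied to \<open>g\<close>: testing
  with the finite vector \<open>w\<^sub>k = \<langle>g|u\<^sub>k\<rangle>\<close> gives
  \<open>\<parallel>w\<parallel>\<^sup>2 = \<langle>U w | g\<rangle> \<le> C \<parallel>w\<parallel> \<parallel>g\<parallel>\<close>, a bound that is uniform in the finite index set.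
\<close>

lemma row_summable:
  assumes u: "\<And>k. u k \<in> L2_torus" and g: "g \<in> L2_torus" and C: "0 \<le> C"
    and le: "\<And>K v. finite K \<Longrightarrow> norm_torus (\<lambda>x. \<Sum>k\<in>K. v k * u k x) \<le> C * L2_set (\<lambda>k. cmod (v k)) K"
  shows "(\<lambda>k::int. (cmod (inner_torus (u k) g))\<^sup>2) summable_on UNIV"
proof (rule nonneg_bdd_above_summable_on)
  show "bdd_above (sum (\<lambda>k. (cmod (inner_torus (u k) g))\<^sup>2) ` {K. K \<subseteq> UNIV \<and> finite K})"
  proof (rule bdd_aboveI2)
    fix K :: "int set" assume "K \<in> {K. K \<subseteq> UNIV \<and> finite K}"
    then have K: "finite K" by simp
    let ?a = "\<lambda>k. inner_torus (u k) g"
    let ?w = "\<lambda>k. cnj (?a k)"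
    define s where "s = L2_set (\<lambda>k. cmod (?a k)) K"
    have s0: "0 \<le> s" by (simp add: s_def L2_set_nonneg)
    have s2: "s\<^sup>2 = (\<Sum>k\<in>K. (cmod (?a k))\<^sup>2)"
      unfolding s_def L2_set_def by (simp add: sum_nonneg)
    have w: "(\<lambda>x. \<Sum>k\<in>K. ?w k * u k x) \<in> L2_torus"
      by (intro L2_sum L2_scale u)
    have "inner_torus (\<lambda>x. \<Sum>k\<in>K. ?w k * u k x) g = (\<Sum>k\<in>K. ?w k * ?a k)"
      by (rule inner_sum_left[OF u g])
    also have "\<dots> = of_real (\<Sum>k\<in>K. (cmod (?a k))\<^sup>2)"
      by (simp only: complex_norm_square of_real_sum mult.commute)
    finally have "s\<^sup>2 = cmod (inner_torus (\<lambda>x. \<Sum>k\<in>K. ?w k * u k x) g)"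
      unfolding s2[symmetric] by (simp add: norm_power)
    also have "\<dots> \<le> norm_torus (\<lambda>x. \<Sum>k\<in>K. ?w k * u k x) * norm_torus g"
      by (rule Cauchy_Schwarz_torus[OF w g])
    also have "\<dots> \<le> (C * s) * norm_torus g"
      using le[OF K, of ?w] by (intro mult_right_mono) (simp_all add: s_def)
    finally have "s * s \<le> (C * norm_torus g) * s"
      by (simp add: power2_eq_square mult_ac)
    then have "s \<le> C * norm_torus g"
      using s0 C by (cases "s = 0") (auto simp: mult_le_cancel_right)
    then have "s\<^sup>2 \<le> (C * norm_torus g)\<^sup>2"
      using s0 by (rule power_mono)
    then show "(\<Sum>k\<in>K. (cmod (?a k))\<^sup>2) \<le> (C * norm_torus g)\<^sup>2"
      by (simp only: s2)
  qed
qed simp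

text \<open>
  An extension is tied to the synthesis map through its values on trigonometric polynomials, and
  orthonormality of the characters turns its norm bound into one by the Euclidean norm of the
  coefficients.
\<close>

lemma bounded_extension_synthesis_bound:
  assumes \<sigma>: "\<And>k. (\<lambda>x. \<sigma> x k) \<in> L2_torus" and A: "bounded_extension_pdo \<sigma> A" and K: "finite K"
  shows "norm_torus (A (\<lambda>x. \<Sum>k\<in>K. v k * chr k x)) = norm_torus (\<lambda>x. \<Sum>k\<in>K. v k * twisted_symbol \<sigma> k x)"
    and "norm_torus (\<lambda>x. \<Sum>k\<in>K. v k * twisted_symbol \<sigma> k x) \<le> operator_norm A * L2_set (\<lambda>k. cmod (v k)) K"
proof -
  have bA: "bounded_operator A"
    using A by (simp add: bounded_extension_pdo_def)
  have p: "(\<lambda>x. \<Sum>k\<in>K. v k * chr k x) \<in> trig_polynomials"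
    using K unfolding trig_polynomials_def by blast
  then have "AE x in torus. A (\<lambda>x. \<Sum>k\<in>K. v k * chr k x) x = pdo \<sigma> (\<lambda>x. \<Sum>k\<in>K. v k * chr k x) x"
    using A unfolding bounded_extension_pdo_def by blast
  then have AE: "AE x in torus. A (\<lambda>x. \<Sum>k\<in>K. v k * chr k x) x = (\<Sum>k\<in>K. v k * twisted_symbol \<sigma> k x)"
    by (simp add: pdo_chr_sum[OF K])
  have "A (\<lambda>x. \<Sum>k\<in>K. v k * chr k x) \<in> L2_torus"
    using bA trig_polynomials_L2[OF p] by (simp add: bounded_operator_def)
  moreover have "(\<lambda>x. \<Sum>k\<in>K. v k * twisted_symbol \<sigma> k x) \<in> L2_torus"
    by (intro L2_sum L2_scale twisted_symbol_L2 \<sigma>)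
  ultimately show eq: "norm_torus (A (\<lambda>x. \<Sum>k\<in>K. v k * chr k x)) = norm_torus (\<lambda>x. \<Sum>k\<in>K. v k * twisted_symbol \<sigma> k x)"
    using AE by (rule norm_torus_cong_AE)
  show "norm_torus (\<lambda>x. \<Sum>k\<in>K. v k * twisted_symbol \<sigma> k x) \<le> operator_norm A * L2_set (\<lambda>k. cmod (v k)) K"
    using operator_norm_nonneg_and_bound(2)[OF bA trig_polynomials_L2[OF p]]
    unfolding eq norm_torus_chr_sum[OF K] .
qed

lemma bounded_extension_exists:
  assumes \<sigma>: "\<And>k. (\<lambda>x. \<sigma> x k) \<in> L2_torus"
    and B: "\<And>n. section_norm n (gram_matrix \<sigma>) \<le> B"
  shows "bounded_extension_pdo \<sigma> (synthesis (twisted_symbol \<sigma>))"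
proof -
  let ?u = "twisted_symbol \<sigma>"
  have u: "?u k \<in> L2_torus" for k by (rule twisted_symbol_L2[OF \<sigma>])
  have B0: "0 \<le> sqrt B"
    using order_trans[OF section_norm_nonneg B] by simp
  have le: "norm_torus (\<lambda>x. \<Sum>k\<in>K. v k * ?u k x) \<le> sqrt B * L2_set (\<lambda>k. cmod (v k)) K"
    if "finite K" for K v
    by (rule norm_synthesis_le[OF u B[unfolded gram_matrix_eq] that])
  show ?thesis
    unfolding bounded_extension_pdo_def
  proof (intro conjI ballI)
    show "bounded_operator (synthesis ?u)"
      by (rule bounded_operator_synthesis(1)[OF u B0 le])
    fix p assume p: "p \<in> trig_polynomials"
    then obtain K c where K: "finite K" and pK: "p = (\<lambda>x. \<Sum>k\<in>K. c k * chr k x)"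
      unfolding trig_polynomials_def by blast
    have pdo: "pdo \<sigma> p = (\<lambda>x. \<Sum>k\<in>K. c k * ?u k x)"
      unfolding pK by (rule pdo_chr_sum[OF K])
    obtain M where M: "\<And>N. M \<le> N \<Longrightarrow> K \<subseteq> {- int N..int N}"
      using finite_subset_symmetric_interval[OF K] by (elim exE) blast
    have "synthesis_section ?u N p = pdo \<sigma> p" if N: "M \<le> N" for N
    proof
      fix x
      have sub: "K \<subseteq> {- int N..int N}"
        by (rule M[OF N])
      have "synthesis_section ?u N p x = (\<Sum>k\<in>K. c k * ?u k x)"
        unfolding synthesis_section_def pK fourier_chr_sum[OF K]
        by (rule sum.mono_neutral_cong_right) (use sub in auto)
      then show "synthesis_section ?u N p x = pdo \<sigma> p x"
        by (simp add: pdo)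
    qed
    then have "eventually (\<lambda>N. synthesis_section ?u N p = pdo \<sigma> p) sequentially"
      by (rule eventually_sequentiallyI)
    moreover have "pdo \<sigma> p \<in> L2_torus"
      unfolding pdo by (intro L2_sum L2_scale u)
    ultimately show "AE x in torus. synthesis ?u p x = pdo \<sigma> p x"
      by (intro bounded_operator_synthesis(2)[OF u B0 le trig_polynomials_L2[OF p]])
  qed
qed

lemma SUP_section_norm_eq:
  assumes \<sigma>: "\<And>k. (\<lambda>x. \<sigma> x k) \<in> L2_torus" and A: "bounded_extension_pdo \<sigma> A"
  shows "(SUP n. ereal (section_norm n (gram_matrix \<sigma>))) = ereal ((operator_norm A)\<^sup>2)"
proof (rule antisym)
  let ?u = "twisted_symbol \<sigma>"
  have u: "?u k \<in> L2_torus" for k by (rule twisted_symbol_L2[OF \<sigma>])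
  have bA: "bounded_operator A"
    using A by (simp add: bounded_extension_pdo_def)
  have sec: "section_norm n (gram_matrix \<sigma>) \<le> (operator_norm A)\<^sup>2" for n
    unfolding gram_matrix_eq
    by (rule section_norm_gram_le[OF u operator_norm_nonneg_and_bound(1)[OF bA]])
       (rule bounded_extension_synthesis_bound(2)[OF \<sigma> A], simp)
  show le: "(SUP n. ereal (section_norm n (gram_matrix \<sigma>))) \<le> ereal ((operator_norm A)\<^sup>2)"
    by (rule SUP_least) (simp add: sec)
  define B where "B = (SUP n. section_norm n (gram_matrix \<sigma>))"
  have bdd: "bdd_above (range (\<lambda>n. section_norm n (gram_matrix \<sigma>)))"
    by (rule bdd_aboveI2[OF sec])
  have B: "section_norm n (gram_matrix \<sigma>) \<le> B" for n
    unfolding B_def by (rule cSUP_upper[OF _ bdd]) simp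
  have B0: "0 \<le> B"
    by (rule order_trans[OF section_norm_nonneg B])
  have "operator_norm A \<le> sqrt B"
  proof (rule operator_norm_le_of_dense[OF bA])
    fix p assume "p \<in> trig_polynomials"
    then obtain K c where K: "finite K" and p: "p = (\<lambda>x. \<Sum>k\<in>K. c k * chr k x)"
      unfolding trig_polynomials_def by blast
    show "norm_torus (A p) \<le> sqrt B * norm_torus p"
      unfolding p bounded_extension_synthesis_bound(1)[OF \<sigma> A K] norm_torus_chr_sum[OF K]
      by (rule norm_synthesis_le[OF u B[unfolded gram_matrix_eq] K])
  qed (simp add: B0)
  then have "(operator_norm A)\<^sup>2 \<le> (sqrt B)\<^sup>2"
    by (rule power_mono) (rule operator_norm_nonneg_and_bound(1)[OF bA])
  then have "ereal ((operator_norm A)\<^sup>2) \<le> ereal B"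
    using B0 by simp
  also have "ereal B = (SUP n. ereal (section_norm n (gram_matrix \<sigma>)))"
    unfolding B_def
  proof (rule ereal_SUP)
    have "ereal (section_norm 0 (gram_matrix \<sigma>)) \<le> (SUP n. ereal (section_norm n (gram_matrix \<sigma>)))"
      by (rule SUP_upper) simp
    with le show "\<bar>SUP n. ereal (section_norm n (gram_matrix \<sigma>))\<bar> \<noteq> \<infinity>"
      by auto
  qed
  finally show "ereal ((operator_norm A)\<^sup>2) \<le> (SUP n. ereal (section_norm n (gram_matrix \<sigma>)))" .
qed

theorem theorem3p2:
  fixes \<sigma> :: "real \<Rightarrow> int \<Rightarrow> complex"
  assumes "(\<lambda>(x, k). \<sigma> x k) \<in> borel_measurable (torus \<Otimes>\<^sub>M count_space UNIV)"
    and "\<And>k. (\<lambda>x. \<sigma> x k) \<in> L2_torus"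
  shows "((\<exists>A. bounded_extension_pdo \<sigma> A) \<longleftrightarrow>
            (\<forall>j. (\<lambda>k. (cmod (assoc_matrix \<sigma> j k))\<^sup>2) summable_on UNIV) \<and>
            (SUP n. ereal (section_norm n (gram_matrix \<sigma>))) < \<infinity>) \<and>
         (\<forall>A. bounded_extension_pdo \<sigma> A \<longrightarrow>
            (SUP n. ereal (section_norm n (gram_matrix \<sigma>))) = ereal ((operator_norm A)\<^sup>2))"
proof -
  note \<sigma> = assms(2)
  have rows: "(\<lambda>k. (cmod (assoc_matrix \<sigma> j k))\<^sup>2) summable_on UNIV"
    if A: "bounded_extension_pdo \<sigma> A" for A j
  proof -
    have "bounded_operator A"
      using A by (simp add: bounded_extension_pdo_def)
    then show ?thesis
      unfolding assoc_matrix_eq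
      by (intro row_summable[OF twisted_symbol_L2[OF \<sigma>] chr_L2 operator_norm_nonneg_and_bound(1)
            bounded_extension_synthesis_bound(2)[OF \<sigma> A]])
  qed
  have ext: "\<exists>A. bounded_extension_pdo \<sigma> A"
    if fin: "(SUP n. ereal (section_norm n (gram_matrix \<sigma>))) < \<infinity>"
  proof -
    define S where "S = (SUP n. ereal (section_norm n (gram_matrix \<sigma>)))"
    have up: "ereal (section_norm n (gram_matrix \<sigma>)) \<le> S" for n
      unfolding S_def by (rule SUP_upper) simp
    have "\<bar>S\<bar> \<noteq> \<infinity>"
      using fin up[of 0] by (auto simp: S_def[symmetric])
    then obtain B where "S = ereal B" by auto
    with up have "section_norm n (gram_matrix \<sigma>) \<le> B" for n
      by simp
    then have "bounded_extension_pdo \<sigma> (synthesis (twisted_symbol \<sigma>))"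
      by (rule bounded_extension_exists[OF \<sigma>])
    then show ?thesis by blast
  qed
  show ?thesis
    using rows ext SUP_section_norm_eq[OF \<sigma>] by (auto simp: less_top[symmetric])
qed

end
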